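(* Let $a_1,\ldots,a_n>0$ and $\psi_1,\ldots,\psi_n\in\mathbb{R}$ be constants. Define $r_1,\ldots,r_n:\mathbb{R}\to\mathbb{R}$ by $r_j(s)=\sqrt{1/a_j+s^2}$ and $\phi_1,\ldots,\phi_n:\mathbb{R}\to\mathbb{R}$ by $$\phi_j(s)=\psi_j+\int_0^s\frac{|t|\,dt}{(1/a_j+t^2)\sqrt{\prod_{k=1}^n(1+a_kt^2)-1}}.$$ Let $L$ be the submanifold of $\mathbb{C}^n$ given by $$L=\Big\{(x_1r_1(s)e^{i\phi_1(s)},\ldots,x_nr_n(s)e^{i\phi_n(s)}):\ \sum_{j=1}^n x_j^2=1,\ x_j\in\mathbb{R},\ s\in\mathbb{R}\Big\},$$ which, as is well known, is a closed embedded special Lagrangian in $(\mathbb{C}^n,\omega_{st})$ diffeomorphic to $\mathcal{S}^{n-1}\times\mathbb{R}$ (one of Lawlor's examples). Then $L$ is special Lagrangian in $(\mathbb{C}^n,\omega_{FS})$ if and only if $a_1=\cdots=a_n$.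
   Context: $\mathbb{C}^n$ has coordinates $z_j=x_j+iy_j$ and the standard almost complex structure $J$ with $J(\partial/\partial x_j)=\partial/\partial y_j$. The standard symplectic form is $\omega_{st}=\frac{i}{2}\sum_{j=1}^n dz_j\wedge d\bar z_j$, the Fubini-Study form is $\omega_{FS}=\frac{i}{2}\partial\bar\partial\log(1+|z_1|^2+\cdots+|z_n|^2)$, and $\Omega=dz_1\wedge\cdots\wedge dz_n$ is the holomorphic $(n,0)$-form. A Lagrangian submanifold is a real $n$-dimensional submanifold on which the symplectic form vanishes. A Lagrangian submanifold $L$ in $(\mathbb{C}^n,J,\omega_{st},\Omega)$ or $(\mathbb{C}^n,J,\omega_{FS},\Omega)$ is called special Lagrangian if $(\mathrm{Im}\,\Omega)|_L=0$ holds.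
   Formalization: Since Im Ω vanishes on L only if cos(ψ_1+…+ψ_n)=0 (it fails for n=1, ψ=0), both special Lagrangian claims are proved under that condition, shown to be exact for ω_st; for all ψ, L is Lagrangian for ω_st, and for ω_FS iff all a_j agree. *)

theory Defs
  imports "HOL-Analysis.Analysis"
begin

section \<open>Smooth maps and submanifolds\<close>

text \<open>
  \<open>Ck_on k U f\<close> is meant for open \<open>U\<close>: all iterated directional derivatives of order at most
  \<open>k\<close> exist in the strong (Frechet) sense and are continuous.
\<close>

primrec Ck_on :: "nat \<Rightarrow> 'a::real_normed_vector set \<Rightarrow> ('a \<Rightarrow> 'b::real_normed_vector) \<Rightarrow> bool" where
  "Ck_on 0 U f \<longleftrightarrow> continuous_on U f"
| "Ck_on (Suc k) U f \<longleftrightarrow>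
     (\<forall>x\<in>U. f differentiable (at x)) \<and> (\<forall>v. Ck_on k U (\<lambda>x. frechet_derivative f (at x) v))"

definition smooth_on :: "'a::real_normed_vector set \<Rightarrow> ('a \<Rightarrow> 'b::real_normed_vector) \<Rightarrow> bool" where
  "smooth_on U f \<longleftrightarrow> open U \<and> (\<forall>k. Ck_on k U f)"

text \<open>Smoothness of a map on an arbitrary subset: local extendability to a smooth map.\<close>

definition smooth_map_on :: "'a::real_normed_vector set \<Rightarrow> ('a \<Rightarrow> 'b::real_normed_vector) \<Rightarrow> bool" where
  "smooth_map_on M f \<longleftrightarrow>
     (\<forall>p\<in>M. \<exists>U g. p \<in> U \<and> smooth_on U g \<and> (\<forall>x\<in>U \<inter> M. g x = f x))"

definition diffeomorphic :: "'a::real_normed_vector set \<Rightarrow> 'b::real_normed_vector set \<Rightarrow> bool" where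
  "diffeomorphic M N \<longleftrightarrow>
     (\<exists>f g. smooth_map_on M f \<and> smooth_map_on N g \<and> f ` M = N \<and> g ` N = M \<and>
            (\<forall>x\<in>M. g (f x) = x) \<and> (\<forall>y\<in>N. f (g y) = y))"

text \<open>
  Embedded submanifolds of \<open>\<complex>\<^sup>n\<close> of real dimension \<open>n\<close>, where \<open>n = CARD('n)\<close>: every point has
  an open neighbourhood \<open>U\<close> such that \<open>U \<inter> L\<close> is the homeomorphic image of an open subset of
  \<open>\<real>\<^sup>n\<close> under a smooth immersion.
\<close>

definition half_dim_submanifold :: "(complex ^ 'n::finite) set \<Rightarrow> bool" where
  "half_dim_submanifold L \<longleftrightarrow>
     (\<forall>p\<in>L. \<exists>U (V :: (real ^ 'n) set) f g.
        open U \<and> p \<in> U \<and> smooth_on V f \<and>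
        (\<forall>u\<in>V. inj (frechet_derivative f (at u))) \<and> homeomorphism V (U \<inter> L) f g)"

definition tangent_space :: "'a::real_normed_vector set \<Rightarrow> 'a \<Rightarrow> 'a set" where
  "tangent_space L p =
     {v. \<exists>e>0. \<exists>\<gamma>. smooth_on {-e<..<e::real} \<gamma> \<and> \<gamma> ` {-e<..<e} \<subseteq> L \<and> \<gamma> 0 = p \<and>
         (\<gamma> has_vector_derivative v) (at 0)}"

section \<open>Differential forms on \<open>\<complex>\<^sup>n\<close>\<close>

text \<open>
  Tangent vectors at any point are identified with elements of \<^typ>\<open>complex ^ 'n\<close>, the
  standard almost complex structure being multiplication by \<open>\<i>\<close>.  A complex-valued
  2-form takes a base point and two tangent vectors.
\<close>

type_synonym 'n form2 = "complex ^ 'n \<Rightarrow> complex ^ 'n \<Rightarrow> complex ^ 'n \<Rightarrow> complex"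

definition dz :: "'n::finite \<Rightarrow> complex ^ 'n \<Rightarrow> complex" where
  "dz j v = v $ j"

definition dzbar :: "'n::finite \<Rightarrow> complex ^ 'n \<Rightarrow> complex" where
  "dzbar j v = cnj (v $ j)"

definition wedge :: "('v \<Rightarrow> complex) \<Rightarrow> ('v \<Rightarrow> complex) \<Rightarrow> 'v \<Rightarrow> 'v \<Rightarrow> complex" where
  "wedge \<alpha> \<beta> u v = \<alpha> u * \<beta> v - \<alpha> v * \<beta> u"

definition partial_x :: "'n::finite \<Rightarrow> (complex ^ 'n \<Rightarrow> complex) \<Rightarrow> complex ^ 'n \<Rightarrow> complex" where
  "partial_x j f z = vector_derivative (\<lambda>t::real. f (z + axis j (complex_of_real t))) (at 0)"

definition partial_y :: "'n::finite \<Rightarrow> (complex ^ 'n \<Rightarrow> complex) \<Rightarrow> complex ^ 'n \<Rightarrow> complex" where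
  "partial_y j f z = vector_derivative (\<lambda>t::real. f (z + axis j (\<i> * complex_of_real t))) (at 0)"

definition partial_z :: "'n::finite \<Rightarrow> (complex ^ 'n \<Rightarrow> complex) \<Rightarrow> complex ^ 'n \<Rightarrow> complex" where
  "partial_z j f z = (partial_x j f z - \<i> * partial_y j f z) / 2"

definition partial_zbar :: "'n::finite \<Rightarrow> (complex ^ 'n \<Rightarrow> complex) \<Rightarrow> complex ^ 'n \<Rightarrow> complex" where
  "partial_zbar j f z = (partial_x j f z + \<i> * partial_y j f z) / 2"

text \<open>\<open>\<partial>(\<Sum>\<^sub>k (\<partial>f/\<partial>zbar\<^sub>k) dzbar\<^sub>k) = \<Sum>\<^sub>j\<^sub>k (\<partial>\<^sup>2f/\<partial>z\<^sub>j\<partial>zbar\<^sub>k) dz\<^sub>j \<and> dzbar\<^sub>k\<close>.\<close>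

definition del_delbar :: "(complex ^ 'n \<Rightarrow> complex) \<Rightarrow> 'n::finite form2" where
  "del_delbar f z u v =
     (\<Sum>j\<in>UNIV. \<Sum>k\<in>UNIV. partial_z j (partial_zbar k f) z * wedge (dz j) (dzbar k) u v)"

definition omega_st :: "'n::finite form2" where
  "omega_st z u v = \<i> / 2 * (\<Sum>j\<in>UNIV. wedge (dz j) (dzbar j) u v)"

definition omega_FS :: "'n::finite form2" where
  "omega_FS z u v =
     \<i> / 2 * del_delbar (\<lambda>w. complex_of_real (ln (1 + (\<Sum>j\<in>UNIV. (cmod (w $ j))\<^sup>2)))) z u v"

text \<open>
  \<open>Omega\<close> is \<open>dz\<^sub>1 \<and> \<dots> \<and> dz\<^sub>n\<close>, evaluated on \<open>n\<close> vectors by the determinant of \<open>dz\<^sub>j (v\<^sub>k)\<close>.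
  Coordinates and arguments are indexed by the same finite type, so no ordering of it is needed.
\<close>

definition Omega :: "('n::finite \<Rightarrow> complex ^ 'n) \<Rightarrow> complex" where
  "Omega v = det (\<chi> j k. dz j (v k))"

definition lagrangian :: "'n::finite form2 \<Rightarrow> (complex ^ 'n) set \<Rightarrow> bool" where
  "lagrangian \<omega> L \<longleftrightarrow> half_dim_submanifold L \<and>
     (\<forall>p\<in>L. \<forall>u\<in>tangent_space L p. \<forall>v\<in>tangent_space L p. \<omega> p u v = 0)"

definition special_lagrangian :: "'n::finite form2 \<Rightarrow> (complex ^ 'n) set \<Rightarrow> bool" where
  "special_lagrangian \<omega> L \<longleftrightarrow> lagrangian \<omega> L \<and>
     (\<forall>p\<in>L. \<forall>v. (\<forall>k. v k \<in> tangent_space L p) \<longrightarrow> Im (Omega v) = 0)"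

section \<open>Lawlor's examples\<close>

definition lawlor_r :: "('n::finite \<Rightarrow> real) \<Rightarrow> 'n \<Rightarrow> real \<Rightarrow> real" where
  "lawlor_r a j s = sqrt (1 / a j + s\<^sup>2)"

text \<open>
  The integrand is \<open>0 / 0 = 0\<close> at \<open>t = 0\<close>, a removable singularity that does not affect the
  integral; the interval integral is oriented, so negative \<open>s\<close> is covered.
\<close>

definition lawlor_phi ::
    "('n::finite \<Rightarrow> real) \<Rightarrow> ('n \<Rightarrow> real) \<Rightarrow> 'n \<Rightarrow> real \<Rightarrow> real" where
  "lawlor_phi a \<psi> j s = \<psi> j +
     (LBINT t=ereal 0..ereal s.
        \<bar>t\<bar> / ((1 / a j + t\<^sup>2) * sqrt ((\<Prod>k\<in>UNIV. 1 + a k * t\<^sup>2) - 1)))"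

definition lawlor :: "('n::finite \<Rightarrow> real) \<Rightarrow> ('n \<Rightarrow> real) \<Rightarrow> (complex ^ 'n) set" where
  "lawlor a \<psi> =
     {(\<chi> j. complex_of_real (x j * lawlor_r a j s) * exp (\<i> * complex_of_real (lawlor_phi a \<psi> j s)))
      | (x :: 'n \<Rightarrow> real) (s :: real). (\<Sum>j\<in>UNIV. (x j)\<^sup>2) = 1}"

text \<open>
  With \<open>n\<close> linearly independent tangent vectors \<open>v\<^sub>k\<close> of \<open>lawlor a \<psi>\<close>, the number \<open>Omega v\<close> is a
  nonzero real multiple of \<open>\<i> * exp (\<i> * (\<psi>\<^sub>1 + \<dots> + \<psi>\<^sub>n))\<close>, at every point.  So the condition on
  \<open>Im Omega\<close> constrains \<open>\<psi>\<close>: it holds if and only if \<open>cos (\<psi>\<^sub>1 + \<dots> + \<psi>\<^sub>n) = 0\<close>.  For other \<open>\<psi>\<close> the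
  submanifold is special Lagrangian only with respect to a rotated form \<open>exp (\<i> * \<theta>) * Omega\<close>.
\<close>

end

theory Submission
  imports Defs
begin

text \<open>
  \<^bold>\<open>Phases.\<close> Write \<open>\<theta>\<^sub>j = \<phi>\<^sub>j - \<psi>\<^sub>j\<close> and \<open>\<Prod>\<^sub>k (1 + a\<^sub>k s\<^sup>2) = 1 + s\<^sup>2 P(s)\<close>.  Here \<open>P\<close> is a positive
  polynomial, so that \<open>\<theta>\<^sub>j' = q / r\<^sub>j\<^sup>2\<close> with \<open>q = 1 / \<surd>P\<close> is smooth and positive, also at \<open>s = 0\<close>.
  Everything about the global shape of \<open>L\<close> and about its Lagrangian angle comes from the identity
  \<open>\<Sum>\<^sub>j \<theta>\<^sub>j(s) = arctan (s \<surd>P(s))\<close> (lemma \<open>sum_angle\<close>), which is verified by differentiation.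

  \<^bold>\<open>Shape.\<close> All \<open>\<theta>\<^sub>j(s)\<close> have the sign of \<open>s\<close>, so the identity forces \<open>\<bar>\<theta>\<^sub>j\<bar> < \<pi>/2\<close>.  Therefore
  \<open>tan \<theta>\<^sub>j\<close> is an increasing function of \<open>s\<close> with a smooth inverse.  Let
  \<open>w\<^sub>j = exp(-i\<psi>\<^sub>j) z\<^sub>j = x\<^sub>j r\<^sub>j exp(i\<theta>\<^sub>j)\<close>.  Wherever \<open>x\<^sub>j \<noteq> 0\<close>, the parameter \<open>s\<close> is read off from
  \<open>Im w\<^sub>j / Re w\<^sub>j = tan \<theta>\<^sub>j(s)\<close>, and then each \<open>x\<^sub>k\<close> from \<open>Re w\<^sub>k = x\<^sub>k r\<^sub>k cos \<theta>\<^sub>k\<close>.  This gives an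
  explicit smooth inverse of the parametrization on an open set of \<open>\<complex>\<^sup>n\<close>.  It yields the
  diffeomorphism with \<open>S\<^sup>n\<^sup>-\<^sup>1 \<times> \<real>\<close>, the charts, and the description of tangent vectors:
  any smooth curve in \<open>L\<close> lifts to a differentiable curve of parameters.

  \<^bold>\<open>Symplectic forms.\<close> The tangent vectors are
  \<open>v\<^sub>j = (r\<^sub>j \<xi>\<^sub>j + \<sigma> x\<^sub>j (s + iq) / r\<^sub>j) exp(i\<phi>\<^sub>j)\<close> with \<open>x \<bullet> \<xi> = 0\<close>.  On two of them
  \<open>\<omega>\<^sub>s\<^sub>t\<close> is a combination of \<open>x \<bullet> \<xi>\<close> and \<open>x \<bullet> \<eta>\<close>, hence zero.  The Fubini-Study form is
  \<open>\<omega>\<^sub>s\<^sub>t / W\<close> plus \<open>Im (A cnj B) / W\<^sup>2\<close>, where \<open>W = 1 + \<bar>z\<bar>\<^sup>2\<close> and \<open>A\<close>, \<open>B\<close> are the Hermitian products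
  of the two vectors with \<open>z\<close>.  Here \<open>A = \<Sum>\<^sub>j x\<^sub>j \<xi>\<^sub>j / a\<^sub>j + \<sigma> (s + iq)\<close>, so that \<open>\<omega>\<^sub>F\<^sub>S\<close> vanishes on
  \<open>L\<close> exactly if \<open>\<Sum>\<^sub>j x\<^sub>j \<xi>\<^sub>j / a\<^sub>j = 0\<close> whenever \<open>x \<bullet> \<xi> = 0\<close>, that is, if all \<open>a\<^sub>j\<close> agree: for
  \<open>x = (e\<^sub>i + e\<^sub>j) / \<surd>2\<close> and \<open>\<xi> = e\<^sub>i - e\<^sub>j\<close> the sum is \<open>(1/a\<^sub>i - 1/a\<^sub>j) / \<surd>2\<close>.

  \<^bold>\<open>Volume form.\<close> On \<open>n\<close> tangent vectors \<open>\<Omega>\<close> is \<open>exp(i \<Sum>\<phi>\<^sub>j)\<close> times the determinant of a real singular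
  matrix plus \<open>s + iq\<close> times a real matrix of rank one.  Such a determinant is a real multiple of
  \<open>s + iq\<close> (lemma \<open>det_real_plus_rank_one\<close>).  By the arctangent identity the argument of
  \<open>exp(i \<Sum>\<theta>\<^sub>j)\<close> complements that of \<open>s + iq\<close> to \<open>\<pi>/2\<close>.  Hence \<open>\<Omega>\<close> lies on the real line through
  \<open>i exp(i \<Sum>\<psi>\<^sub>j)\<close>, and \<open>Im \<Omega>\<close> vanishes on \<open>L\<close> exactly if \<open>cos (\<Sum>\<psi>\<^sub>j) = 0\<close>.
\<close>


section \<open>Calculus of smooth maps\<close>

lemma Ck_on_imp_continuous_on:
  "Ck_on k U f \<Longrightarrow> continuous_on U f"
  by (cases k) (auto intro!: continuous_at_imp_continuous_on differentiable_imp_continuous_within)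

lemma Ck_on_Suc_imp: "Ck_on (Suc k) U f \<Longrightarrow> Ck_on k U f"
proof (induction k arbitrary: f)
  case 0
  then show ?case by (simp only: Ck_on.simps(1) Ck_on_imp_continuous_on)
next
  case (Suc k)
  show ?case unfolding Ck_on.simps(2)[of k]
    using Suc.prems Suc.IH unfolding Ck_on.simps(2)[of "Suc k"] by blast
qed

lemma Ck_on_subset: "Ck_on k U f \<Longrightarrow> V \<subseteq> U \<Longrightarrow> Ck_on k V f"
  by (induction k arbitrary: f) (auto intro: continuous_on_subset)

text \<open>
  The defining recursion passes to the function \<open>frechet_derivative f (at x) v\<close>, which is determined
  by \<open>f\<close> near \<open>x\<close>.  Congruence on open sets allows it to be replaced by an explicit formula
  for the derivative that is valid on \<open>U\<close> only.
\<close>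

lemma Ck_on_cong:
  assumes "open U" "\<And>x. x \<in> U \<Longrightarrow> f x = g x" "Ck_on k U f"
  shows "Ck_on k U g"
  using assms(2,3)
proof (induction k arbitrary: f g)
  case 0
  then show ?case by (auto cong: continuous_on_cong)
next
  case (Suc k)
  have der: "(g has_derivative frechet_derivative f (at x)) (at x)" if "x \<in> U" for x
    using Suc.prems(2) that has_derivative_transform_within_open[OF _ \<open>open U\<close> that Suc.prems(1)]
    by (auto simp: frechet_derivative_works)
  have "Ck_on k U (\<lambda>x. frechet_derivative g (at x) v)" for v
  proof (rule Suc.IH)
    show "Ck_on k U (\<lambda>x. frechet_derivative f (at x) v)" using Suc.prems(2) by simp
    show "frechet_derivative f (at x) v = frechet_derivative g (at x) v" if "x \<in> U" for x
      using frechet_derivative_at[OF der[OF that]] by simp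
  qed
  then show ?case using der by (auto simp: differentiable_def)
qed

lemma Ck_on_SucI:
  assumes "open U" "\<And>x. x \<in> U \<Longrightarrow> (f has_derivative f' x) (at x)" "\<And>v. Ck_on k U (\<lambda>x. f' x v)"
  shows "Ck_on (Suc k) U f"
proof -
  have "Ck_on k U (\<lambda>x. frechet_derivative f (at x) v)" for v
    by (rule Ck_on_cong[OF assms(1) _ assms(3)[of v]])
       (simp add: frechet_derivative_at[OF assms(2), symmetric])
  then show ?thesis using assms(2) by (auto simp: differentiable_def)
qed

lemma Ck_on_SucD:
  assumes "Ck_on (Suc k) U f" "x \<in> U"
  shows "(f has_derivative frechet_derivative f (at x)) (at x)"
  using assms by (auto simp: frechet_derivative_works)

lemma Ck_on_const: "open U \<Longrightarrow> Ck_on k U (\<lambda>x. c)"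
proof (induction k arbitrary: c)
  case (Suc k)
  show ?case by (rule Ck_on_SucI[OF Suc.prems has_derivative_const]) (rule Suc.IH[OF Suc.prems])
qed simp

lemma Ck_on_linear:
  assumes "bounded_linear h" "open U" "Ck_on k U f"
  shows "Ck_on k U (\<lambda>x. h (f x))"
  using assms(3)
proof (induction k arbitrary: f)
  case 0
  then show ?case using bounded_linear.continuous_on[OF assms(1)] by auto
next
  case (Suc k)
  show ?case
  proof (rule Ck_on_SucI[OF assms(2)])
    show "((\<lambda>x. h (f x)) has_derivative (\<lambda>v. h (frechet_derivative f (at x) v))) (at x)" if "x \<in> U" for x
      by (rule bounded_linear.has_derivative[OF assms(1) Ck_on_SucD[OF Suc.prems that]])
    show "Ck_on k U (\<lambda>x. h (frechet_derivative f (at x) v))" for v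
      by (rule Suc.IH) (use Suc.prems in simp)
  qed
qed

lemma Ck_on_id: "open U \<Longrightarrow> Ck_on k U (\<lambda>x. x)"
  by (cases k) (auto intro!: Ck_on_SucI[where f' = "\<lambda>x v. v"] Ck_on_const simp del: Ck_on.simps(2))

lemma Ck_on_add:
  assumes "open U" "Ck_on k U f" "Ck_on k U g"
  shows "Ck_on k U (\<lambda>x. f x + g x)"
  using assms(2,3)
proof (induction k arbitrary: f g)
  case 0
  then show ?case by (auto intro: continuous_intros)
next
  case (Suc k)
  show ?case
  proof (rule Ck_on_SucI[OF assms(1)])
    show "((\<lambda>x. f x + g x) has_derivative
      (\<lambda>v. frechet_derivative f (at x) v + frechet_derivative g (at x) v)) (at x)" if "x \<in> U" for x
      by (intro has_derivative_add Ck_on_SucD[OF Suc.prems(1) that] Ck_on_SucD[OF Suc.prems(2) that])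
    show "Ck_on k U (\<lambda>x. frechet_derivative f (at x) v + frechet_derivative g (at x) v)" for v
      by (rule Suc.IH) (use Suc.prems in simp_all)
  qed
qed

lemma Ck_on_bilinear:
  assumes "bounded_bilinear h" "open U" "Ck_on k U f" "Ck_on k U g"
  shows "Ck_on k U (\<lambda>x. h (f x) (g x))"
  using assms(3,4)
proof (induction k arbitrary: f g)
  case 0
  then show ?case using bounded_bilinear.continuous_on[OF assms(1)] by auto
next
  case (Suc k)
  show ?case
  proof (rule Ck_on_SucI[OF assms(2)])
    show "((\<lambda>x. h (f x) (g x)) has_derivative
      (\<lambda>v. h (f x) (frechet_derivative g (at x) v) + h (frechet_derivative f (at x) v) (g x))) (at x)"
      if "x \<in> U" for x
      by (rule bounded_bilinear.FDERIV[OF assms(1) Ck_on_SucD[OF Suc.prems(1) that]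
           Ck_on_SucD[OF Suc.prems(2) that]])
    show "Ck_on k U (\<lambda>x. h (f x) (frechet_derivative g (at x) v)
                       + h (frechet_derivative f (at x) v) (g x))" for v
      by (intro Ck_on_add Suc.IH assms(2) Ck_on_Suc_imp[OF Suc.prems(1)] Ck_on_Suc_imp[OF Suc.prems(2)])
         (use Suc.prems in simp_all)
  qed
qed

lemma Ck_on_sum:
  assumes "open U" "\<And>i. i \<in> I \<Longrightarrow> Ck_on k U (f i)"
  shows "Ck_on k U (\<lambda>x. \<Sum>i\<in>I. f i x)"
  using assms(2) by (induction I rule: infinite_finite_induct) (auto intro: Ck_on_const Ck_on_add assms(1))

text \<open>
  The chain rule applies the derivative of \<open>g\<close> at \<open>f x\<close> to a vector that varies with \<open>x\<close>, whereas
  \<open>Ck_on\<close> speaks about fixed directions.  A basis of the intermediate space repairs this: the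
  derivative of the composition is a finite sum of products of \<open>Ck\<close> functions.  This is
  why the intermediate space is Euclidean.
\<close>

lemma Ck_on_compose:
  fixes f :: "'a::real_normed_vector \<Rightarrow> 'b::euclidean_space"
  assumes "open U" "f ` U \<subseteq> V" "Ck_on k V g" "Ck_on k U f"
  shows "Ck_on k U (\<lambda>x. g (f x))"
  using assms(3,4)
proof (induction k arbitrary: g)
  case 0
  then show ?case using continuous_on_compose2 assms(2) by auto
next
  case (Suc k)
  let ?Df = "\<lambda>x. frechet_derivative f (at x)" and ?Dg = "\<lambda>x. frechet_derivative g (at x)"
  show ?case
  proof (rule Ck_on_SucI[OF assms(1)])
    show "((\<lambda>x. g (f x)) has_derivative (\<lambda>v. \<Sum>b\<in>Basis. (?Df x v \<bullet> b) *\<^sub>R ?Dg (f x) b)) (at x)"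
      if "x \<in> U" for x
    proof -
      have dg: "(g has_derivative ?Dg (f x)) (at (f x))"
        using Ck_on_SucD[OF Suc.prems(1)] assms(2) that by blast
      interpret bounded_linear "?Dg (f x)" by (rule has_derivative_bounded_linear[OF dg])
      have "((\<lambda>x. g (f x)) has_derivative (\<lambda>v. ?Dg (f x) (?Df x v))) (at x)"
        by (rule has_derivative_compose[OF Ck_on_SucD[OF Suc.prems(2) that] dg])
      moreover have "?Dg (f x) (?Df x v) = (\<Sum>b\<in>Basis. (?Df x v \<bullet> b) *\<^sub>R ?Dg (f x) b)" for v
      proof -
        have "?Dg (f x) (?Df x v) = ?Dg (f x) (\<Sum>b\<in>Basis. (?Df x v \<bullet> b) *\<^sub>R b)"
          by (simp add: euclidean_representation)
        then show ?thesis by (simp only: sum scaleR)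
      qed
      ultimately show ?thesis by (simp only:)
    qed
    show "Ck_on k U (\<lambda>x. \<Sum>b\<in>Basis. (?Df x v \<bullet> b) *\<^sub>R ?Dg (f x) b)" for v
    proof (intro Ck_on_sum assms(1) Ck_on_bilinear[OF bounded_bilinear_scaleR])
      fix b :: 'b
      show "Ck_on k U (\<lambda>x. ?Df x v \<bullet> b)"
        by (rule Ck_on_linear[OF bounded_linear_inner_left assms(1)]) (use Suc.prems(2) in simp)
      show "Ck_on k U (\<lambda>x. ?Dg (f x) b)"
        by (rule Suc.IH[OF _ Ck_on_Suc_imp[OF Suc.prems(2)]]) (use Suc.prems(1) in simp)
    qed
  qed
qed

lemma Ck_on_Suc_real:
  assumes "open U" "\<And>x. x \<in> U \<Longrightarrow> (f has_vector_derivative f' x) (at x)" "Ck_on k U f'"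
  shows "Ck_on (Suc k) U f"
  by (rule Ck_on_SucI[OF assms(1) assms(2)[unfolded has_vector_derivative_def]])
     (assumption, rule Ck_on_linear[OF bounded_linear_scaleR_right assms(1,3)])

lemma smooth_on_open: "smooth_on U f \<Longrightarrow> open U"
  by (simp add: smooth_on_def)

lemma smooth_on_imp_continuous_on: "smooth_on U f \<Longrightarrow> continuous_on U f"
  using Ck_on_imp_continuous_on by (auto simp: smooth_on_def)

lemma smooth_on_has_derivative:
  "smooth_on U f \<Longrightarrow> x \<in> U \<Longrightarrow> (f has_derivative frechet_derivative f (at x)) (at x)"
  unfolding smooth_on_def using Ck_on_SucD by blast

lemma smooth_on_subset: "smooth_on U f \<Longrightarrow> V \<subseteq> U \<Longrightarrow> open V \<Longrightarrow> smooth_on V f"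
  by (auto simp: smooth_on_def intro: Ck_on_subset)

lemma smooth_on_const: "open U \<Longrightarrow> smooth_on U (\<lambda>x. c)"
  by (simp add: smooth_on_def Ck_on_const)

lemma smooth_on_id: "open U \<Longrightarrow> smooth_on U (\<lambda>x. x)"
  by (simp add: smooth_on_def Ck_on_id)

lemma smooth_on_linear: "bounded_linear h \<Longrightarrow> smooth_on U f \<Longrightarrow> smooth_on U (\<lambda>x. h (f x))"
  by (simp add: smooth_on_def Ck_on_linear)

lemma smooth_on_add: "smooth_on U f \<Longrightarrow> smooth_on U g \<Longrightarrow> smooth_on U (\<lambda>x. f x + g x)"
  by (simp add: smooth_on_def Ck_on_add)

lemma smooth_on_diff: "smooth_on U f \<Longrightarrow> smooth_on U g \<Longrightarrow> smooth_on U (\<lambda>x. f x - g x)"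
  using smooth_on_add[OF _ smooth_on_linear[OF bounded_linear_minus[OF bounded_linear_ident]]] by fastforce

lemma smooth_on_mult:
  fixes f g :: "'a::real_normed_vector \<Rightarrow> 'b::real_normed_algebra"
  shows "smooth_on U f \<Longrightarrow> smooth_on U g \<Longrightarrow> smooth_on U (\<lambda>x. f x * g x)"
  by (simp add: smooth_on_def Ck_on_bilinear[OF bounded_bilinear_mult])

lemma smooth_on_scaleR: "smooth_on U f \<Longrightarrow> smooth_on U g \<Longrightarrow> smooth_on U (\<lambda>x. f x *\<^sub>R g x)"
  by (simp add: smooth_on_def Ck_on_bilinear[OF bounded_bilinear_scaleR])

lemma smooth_on_sum:
  "open U \<Longrightarrow> (\<And>i. i \<in> I \<Longrightarrow> smooth_on U (f i)) \<Longrightarrow> smooth_on U (\<lambda>x. \<Sum>i\<in>I. f i x)"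
  by (simp add: smooth_on_def Ck_on_sum)

lemma smooth_on_compose:
  fixes f :: "'a::real_normed_vector \<Rightarrow> 'b::euclidean_space"
  shows "smooth_on V g \<Longrightarrow> smooth_on U f \<Longrightarrow> f ` U \<subseteq> V \<Longrightarrow> smooth_on U (\<lambda>x. g (f x))"
  by (simp add: smooth_on_def Ck_on_compose[of _ f])

lemma smooth_on_power2:
  fixes f :: "'a::real_normed_vector \<Rightarrow> real"
  shows "smooth_on U f \<Longrightarrow> smooth_on U (\<lambda>x. (f x)\<^sup>2)"
  by (simp add: power2_eq_square smooth_on_mult)

lemma smooth_on_Pair:
  assumes "smooth_on U f" "smooth_on U g"
  shows "smooth_on U (\<lambda>x. (f x, g x))"
proof -
  have "smooth_on U (\<lambda>x. (f x, 0) + (0, g x))"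
    by (intro smooth_on_add smooth_on_linear[OF _ assms(1)] smooth_on_linear[OF _ assms(2)]
         bounded_linear_Pair bounded_linear_ident bounded_linear_zero)
  then show ?thesis by simp
qed

lemma bounded_linear_axis: "bounded_linear (axis i :: 'a::euclidean_space \<Rightarrow> 'a ^ 'n::finite)"
  by (rule linear_conv_bounded_linear[THEN iffD1]) (auto intro!: linearI simp: vec_eq_iff axis_def)

lemma smooth_on_vec:
  fixes f :: "'n::finite \<Rightarrow> 'a::real_normed_vector \<Rightarrow> 'b::euclidean_space"
  assumes "open U" "\<And>i. smooth_on U (f i)"
  shows "smooth_on U (\<lambda>x. \<chi> i. f i x)"
proof -
  have "smooth_on U (\<lambda>x. \<Sum>i\<in>UNIV. axis i (f i x))"
    by (intro smooth_on_sum smooth_on_linear[OF bounded_linear_axis] assms)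
  moreover have "(\<Sum>i\<in>UNIV. axis i (f i x)) = (\<chi> i. f i x)" for x
    by (simp add: vec_eq_iff axis_def if_distrib cong: if_cong)
  ultimately show ?thesis by simp
qed

lemma smooth_on_inverse_real: "smooth_on (- {0}) (inverse :: real \<Rightarrow> real)"
proof -
  have "Ck_on k (- {0}) (inverse :: real \<Rightarrow> real)" for k
  proof (induction k)
    case 0
    show ?case by (auto intro!: continuous_intros)
  next
    case (Suc k)
    have op: "open (- {0::real})" by (simp add: open_Compl)
    show ?case
    proof (rule Ck_on_Suc_real[OF op])
      show "(inverse has_vector_derivative - 1 * (inverse x * inverse x)) (at x)" if "x \<in> - {0}" for x :: real
        using that by (auto intro!: derivative_eq_intros simp: has_real_derivative_iff_has_vector_derivative[symmetric])
      show "Ck_on k (- {0}) (\<lambda>x::real. - 1 * (inverse x * inverse x))"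
        by (intro Ck_on_bilinear[OF bounded_bilinear_mult] Ck_on_const Suc op)
    qed
  qed
  then show ?thesis by (simp add: smooth_on_def open_Compl)
qed

lemma smooth_on_inverse:
  fixes f :: "'a::real_normed_vector \<Rightarrow> real"
  shows "smooth_on U f \<Longrightarrow> (\<And>x. x \<in> U \<Longrightarrow> f x \<noteq> 0) \<Longrightarrow> smooth_on U (\<lambda>x. inverse (f x))"
  by (rule smooth_on_compose[OF smooth_on_inverse_real]) auto

lemma smooth_on_divide:
  fixes f g :: "'a::real_normed_vector \<Rightarrow> real"
  shows "smooth_on U f \<Longrightarrow> smooth_on U g \<Longrightarrow> (\<And>x. x \<in> U \<Longrightarrow> g x \<noteq> 0) \<Longrightarrow> smooth_on U (\<lambda>x. f x / g x)"
  by (simp add: divide_inverse smooth_on_mult smooth_on_inverse)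

lemma smooth_on_sqrt:
  fixes f :: "'a::real_normed_vector \<Rightarrow> real"
  assumes "smooth_on U f" "\<And>x. x \<in> U \<Longrightarrow> f x > 0"
  shows "smooth_on U (\<lambda>x. sqrt (f x))"
proof (rule smooth_on_compose[OF _ assms(1)])
  have op: "open {0::real<..}" by simp
  have "Ck_on k {0<..} sqrt" for k
  proof (induction k)
    case 0
    show ?case by (auto intro!: continuous_intros)
  next
    case (Suc k)
    show ?case
    proof (rule Ck_on_Suc_real[OF op])
      show "(sqrt has_vector_derivative inverse (sqrt x) * (1 / 2)) (at x)" if "x \<in> {0<..}" for x :: real
        using that by (auto intro!: derivative_eq_intros simp: has_real_derivative_iff_has_vector_derivative[symmetric])
      show "Ck_on k {0<..} (\<lambda>x. inverse (sqrt x) * (1 / 2))"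
        by (intro Ck_on_bilinear[OF bounded_bilinear_mult] Ck_on_const op
              Ck_on_compose[OF _ _ _ Suc, where V = "- {0}"])
           (use smooth_on_inverse_real in \<open>auto simp: smooth_on_def\<close>)
    qed
  qed
  then show "smooth_on {0<..} sqrt" by (simp add: smooth_on_def)
qed (use assms(2) in auto)

lemma smooth_on_exp_i:
  fixes f :: "'a::real_normed_vector \<Rightarrow> real"
  assumes "smooth_on U f"
  shows "smooth_on U (\<lambda>x. exp (\<i> * complex_of_real (f x)))"
proof (rule smooth_on_compose[OF _ assms])
  have "Ck_on k UNIV (\<lambda>t. exp (\<i> * complex_of_real t))" for k
  proof (induction k)
    case 0
    show ?case by (auto intro!: continuous_intros)
  next
    case (Suc k)
    show ?case
    proof (rule Ck_on_Suc_real[OF open_UNIV])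
      show "((\<lambda>t. exp (\<i> * complex_of_real t)) has_vector_derivative \<i> * exp (\<i> * complex_of_real x)) (at x)" for x
        by (auto intro!: derivative_eq_intros has_vector_derivative_real_field)
      show "Ck_on k UNIV (\<lambda>x. \<i> * exp (\<i> * complex_of_real x))"
        by (rule Ck_on_linear[OF bounded_linear_mult_right open_UNIV Suc])
    qed
  qed
  then show "smooth_on UNIV (\<lambda>t. exp (\<i> * complex_of_real t))" by (simp add: smooth_on_def)
qed simp

lemma smooth_on_cos: "smooth_on U f \<Longrightarrow> smooth_on U (\<lambda>x. cos (f x :: real))"
  using smooth_on_linear[OF bounded_linear_Re smooth_on_exp_i[of U f]]
  by (simp add: exp_Euler sin_of_real cos_of_real)

lemma smooth_on_antiderivative:
  assumes "open U" "smooth_on U f'" "\<And>x. x \<in> U \<Longrightarrow> (f has_vector_derivative f' x) (at x)"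
  shows "smooth_on U f"
  unfolding smooth_on_def
proof (intro conjI allI)
  fix k
  show "Ck_on k U f" 
    by (rule Ck_on_Suc_imp, rule Ck_on_Suc_real[OF assms(1,3)]) (use assms(2) in \<open>auto simp: smooth_on_def\<close>)
qed (rule assms(1))

text \<open>
  The derivative of the inverse is \<open>1 / (f' \<circ> h)\<close>, so \<open>h\<close> gains one order of differentiability from
  its own; this bootstraps continuity to smoothness.
\<close>

lemma smooth_on_inverse_function:
  fixes f h :: "real \<Rightarrow> real"
  assumes smooth: "smooth_on UNIV f'"
    and deriv: "\<And>x. (f has_real_derivative f' x) (at x)"
    and pos: "\<And>x. f' x > 0"
    and inv: "\<And>x. h (f x) = x"
  shows "smooth_on (range f) h"
proof -
  have cont: "continuous_on UNIV f"
    by (meson deriv DERIV_isCont continuous_at_imp_continuous_on)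
  have op: "open (range f)"
    by (rule injective_into_1d_imp_open_map_UNIV[OF _ cont]) (use inv in \<open>auto intro: inj_on_inverseI\<close>)
  have dh: "(h has_vector_derivative inverse (f' (h y))) (at y)" if y: "y \<in> range f" for y
  proof -
    obtain x where x: "y = f x" using y by blast
    have "isCont h (f x)"
      by (rule isCont_inverse_function[of 1]) (simp_all add: inv DERIV_isCont[OF deriv])
    moreover obtain e where e: "e > 0" "ball y e \<subseteq> range f"
      using op y open_contains_ball by blast
    moreover have "f (h z) = z" if "y - e < z" "z < y + e" for z
    proof -
      have "z \<in> range f" using that e(2) by (auto simp: dist_real_def abs_real_def)
      then show ?thesis using inv by auto
    qed
    ultimately have "(h has_real_derivative inverse (f' (h y))) (at y)"
      by (intro DERIV_inverse_function[where f = f and a = "y - e" and b = "y + e"])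
         (simp_all add: deriv x inv less_imp_neq[OF pos, symmetric])
    then show ?thesis by (simp add: has_real_derivative_iff_has_vector_derivative)
  qed
  have "Ck_on k (range f) h" for k
  proof (induction k)
    case 0
    show ?case
      using has_vector_derivative_continuous[OF dh] by (simp add: continuous_at_imp_continuous_on)
  next
    case (Suc k)
    have "Ck_on k (range f) (\<lambda>y. f' (h y))"
      by (rule Ck_on_compose[OF op _ _ Suc, where V = UNIV]) (use smooth in \<open>auto simp: smooth_on_def\<close>)
    then have "Ck_on k (range f) (\<lambda>y. inverse (f' (h y)))"
      by (rule Ck_on_compose[OF op, where V = "- {0}", rotated 2])
         (use smooth_on_inverse_real pos in \<open>auto simp: smooth_on_def less_le\<close>)
    with dh show ?case by (rule Ck_on_Suc_real[OF op])
  qed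
  then show ?thesis by (simp add: smooth_on_def op)
qed

lemma has_vector_derivative_vec:
  fixes f :: "'n::finite \<Rightarrow> real \<Rightarrow> 'b::euclidean_space"
  assumes "\<And>i. (f i has_vector_derivative f' i) (at t)"
  shows "((\<lambda>t. \<chi> i. f i t) has_vector_derivative (\<chi> i. f' i)) (at t)"
proof -
  have eq: "(\<Sum>i\<in>UNIV. axis i (g i)) = (\<chi> i. g i)" for g :: "'n \<Rightarrow> 'b"
    by (simp add: vec_eq_iff axis_def if_distrib cong: if_cong)
  have "((\<lambda>t. \<Sum>i\<in>UNIV. axis i (f i t)) has_vector_derivative (\<Sum>i\<in>UNIV. axis i (f' i))) (at t)"
    by (intro has_vector_derivative_sum bounded_linear.has_vector_derivative[OF bounded_linear_axis] assms)
  then show ?thesis by (simp add: eq)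
qed

lemma sphere_iff_sum_squares: "x \<in> sphere 0 1 \<longleftrightarrow> (\<Sum>j\<in>UNIV. (x $ j)\<^sup>2) = 1" for x :: "real ^ 'n::finite"
  by (simp add: norm_vec_def L2_set_def)

lemma unit_vector_nonzero_coordinate:
  fixes x :: "real ^ 'n::finite"
  assumes "x \<in> sphere 0 1"
  obtains j where "x $ j \<noteq> 0"
proof -
  have "x \<noteq> 0" using assms by auto
  then show ?thesis using that by (auto simp: vec_eq_iff)
qed

section \<open>The phase functions\<close>

text \<open>
  The quotient \<open>(\<Prod>(1 + a\<^sub>k t\<^sup>2) - 1) / t\<^sup>2\<close> with its singularity at 0 removed.
\<close>

definition excess :: "('n::finite \<Rightarrow> real) \<Rightarrow> real \<Rightarrow> real" where
  "excess a t = (if t = 0 then \<Sum>k\<in>UNIV. a k else ((\<Prod>k\<in>UNIV. 1 + a k * t\<^sup>2) - 1) / t\<^sup>2)"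

text \<open>
  Adding one factor to the product replaces the quotient \<open>P\<close> by \<open>P + a\<^sub>i (1 + t\<^sup>2 P)\<close>.  Induction over
  the factors therefore shows that the quotient is smooth through 0 and bounded below by
  the sum of the \<open>a\<^sub>k\<close>, hence positive.
\<close>

lemma ex_smooth_excess:
  fixes a :: "'n \<Rightarrow> real"
  assumes "finite S" "\<And>k. a k > 0"
  shows "\<exists>P. smooth_on UNIV P \<and> P 0 = (\<Sum>k\<in>S. a k) \<and>
    (\<forall>t. (\<Prod>k\<in>S. 1 + a k * t\<^sup>2) = 1 + t\<^sup>2 * P t) \<and> (\<forall>t. (\<Sum>k\<in>S. a k) \<le> P t)"
  using assms(1)
proof (induction S rule: finite_induct)
  case empty
  show ?case by (rule exI[of _ "\<lambda>t. 0"]) (simp add: smooth_on_const)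
next
  case (insert i S)
  then obtain P where P: "smooth_on UNIV P" "P 0 = (\<Sum>k\<in>S. a k)"
    "\<And>t. (\<Prod>k\<in>S. 1 + a k * t\<^sup>2) = 1 + t\<^sup>2 * P t" "\<And>t. (\<Sum>k\<in>S. a k) \<le> P t"
    by blast
  have "smooth_on UNIV (\<lambda>t. P t + a i * (1 + t\<^sup>2 * P t))"
    by (intro smooth_on_add smooth_on_mult smooth_on_power2 smooth_on_const smooth_on_id P(1)) auto
  moreover have "(\<Sum>k\<in>insert i S. a k) \<le> P t + a i * (1 + t\<^sup>2 * P t)" for t
  proof -
    have "0 \<le> P t" using P(4)[of t] assms(2) sum_nonneg[of S a] by (smt (verit))
    then have "a i * 1 \<le> a i * (1 + t\<^sup>2 * P t)"
      using assms(2)[of i] by (intro mult_left_mono) auto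
    then show ?thesis using insert.hyps P(4)[of t] by simp
  qed
  moreover have "(\<Prod>k\<in>insert i S. 1 + a k * t\<^sup>2) = 1 + t\<^sup>2 * (P t + a i * (1 + t\<^sup>2 * P t))" for t
    using insert.hyps P(3)[of t] by (simp add: algebra_simps power2_eq_square)
  ultimately show ?case
    using insert.hyps P(2) by (intro exI[of _ "\<lambda>t. P t + a i * (1 + t\<^sup>2 * P t)"]) auto
qed

lemma has_real_derivative_one_plus_square:
  "(f has_real_derivative D) (at s) \<Longrightarrow> ((\<lambda>s. 1 + (f s)\<^sup>2) has_real_derivative 2 * f s * D) (at s)"
  by (auto intro!: derivative_eq_intros)

text \<open>
  The \<open>s\<close>-derivative of each coordinate of the parametrization is \<open>s + i q\<close> times a real number and
  the unit number \<open>exp(i\<phi>\<^sub>j)\<close>.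
\<close>

definition lawlor_q :: "('n::finite \<Rightarrow> real) \<Rightarrow> real \<Rightarrow> real" where
  "lawlor_q a s = 1 / sqrt (excess a s)"

text \<open>
  The phase with the constant \<open>\<psi>\<^sub>j\<close> removed, called \<open>\<theta>\<^sub>j\<close> above.
\<close>

definition lawlor_angle :: "('n::finite \<Rightarrow> real) \<Rightarrow> 'n \<Rightarrow> real \<Rightarrow> real" where
  "lawlor_angle a j s = lawlor_phi a (\<lambda>_. 0) j s"

lemma lawlor_phi_eq: "lawlor_phi a \<psi> j s = \<psi> j + lawlor_angle a j s"
  by (simp add: lawlor_phi_def lawlor_angle_def)

locale lawlor_parameters =
  fixes a \<psi> :: "'n::finite \<Rightarrow> real"
  assumes a_pos: "\<And>j. a j > 0"
begin

lemma excess_smooth: "smooth_on UNIV (excess a)"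
  and excess_mult: "t\<^sup>2 * excess a t = (\<Prod>k\<in>UNIV. 1 + a k * t\<^sup>2) - 1"
  and excess_pos: "excess a t > 0"
proof -
  obtain P where P: "smooth_on UNIV P" "P 0 = (\<Sum>k\<in>UNIV. a k)"
    "\<And>t. (\<Prod>k\<in>UNIV. 1 + a k * t\<^sup>2) = 1 + t\<^sup>2 * P t" "\<And>t. (\<Sum>k\<in>UNIV. a k) \<le> P t"
    using ex_smooth_excess[of UNIV a] a_pos by auto
  have eq: "excess a = P" using P by (auto simp: excess_def fun_eq_iff)
  show "smooth_on UNIV (excess a)" using P eq by simp
  show "t\<^sup>2 * excess a t = (\<Prod>k\<in>UNIV. 1 + a k * t\<^sup>2) - 1" using P eq by simp
  have "(\<Sum>k\<in>UNIV. a k) > 0" using a_pos by (simp add: sum_pos)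
  then show "excess a t > 0" using P(4)[of t] eq by simp
qed

lemma q_pos: "lawlor_q a s > 0"
  by (simp add: lawlor_q_def excess_pos)

lemma r_sq_pos: "1 / a j + s\<^sup>2 > 0"
  using a_pos[of j] by (simp add: add_pos_nonneg)

lemma r_pos: "lawlor_r a j s > 0"
  using r_sq_pos by (simp add: lawlor_r_def)

lemma r_sq: "(lawlor_r a j s)\<^sup>2 = 1 / a j + s\<^sup>2"
  using r_sq_pos[of j s] by (simp add: lawlor_r_def)

lemma q_smooth: "smooth_on UNIV (lawlor_q a)"
  unfolding lawlor_q_def
  by (intro smooth_on_divide smooth_on_sqrt excess_smooth smooth_on_const)
     (auto simp: excess_pos less_imp_neq[OF excess_pos, symmetric])

lemma r_smooth: "smooth_on UNIV (lawlor_r a j)"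
  unfolding lawlor_r_def[abs_def]
  by (intro smooth_on_sqrt smooth_on_add smooth_on_power2 smooth_on_const smooth_on_id r_sq_pos) auto

lemma r_deriv: "(lawlor_r a j has_real_derivative s / lawlor_r a j s) (at s)"
  unfolding lawlor_r_def[abs_def] using r_sq_pos[of j s]
  by (auto intro!: derivative_eq_intros simp: field_simps)

lemma angle_deriv_smooth: "smooth_on UNIV (\<lambda>s. lawlor_q a s / (lawlor_r a j s)\<^sup>2)"
  by (intro smooth_on_divide smooth_on_power2 q_smooth r_smooth)
     (simp add: less_imp_neq[OF r_pos, symmetric])

text \<open>
  Away from 0 the integrand \<open>\<bar>t\<bar> / ((1/a\<^sub>j + t\<^sup>2) \<surd>(\<Prod>(1 + a\<^sub>k t\<^sup>2) - 1))\<close> equals \<open>q / r\<^sub>j\<^sup>2\<close>, because the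
  root contributes \<open>\<bar>t\<bar> \<surd>(excess a t)\<close>.  The two differ only at the end point 0 of the integral, so the
  fundamental theorem of calculus applies to the continuous function \<open>q / r\<^sub>j\<^sup>2\<close>.
\<close>

lemma angle_deriv:
  "(lawlor_angle a j has_real_derivative lawlor_q a s / (lawlor_r a j s)\<^sup>2) (at s)"
proof -
  let ?f = "\<lambda>s. lawlor_q a s / (lawlor_r a j s)\<^sup>2"
  have angle: "lawlor_angle a j = (\<lambda>s. LBINT t=ereal 0..ereal s. ?f t)"
  proof
    fix s
    have eq: "\<bar>t\<bar> / ((1 / a j + t\<^sup>2) * sqrt ((\<Prod>k\<in>UNIV. 1 + a k * t\<^sup>2) - 1)) = ?f t" if "t \<noteq> 0" for t
    proof -
      have "sqrt ((\<Prod>k\<in>UNIV. 1 + a k * t\<^sup>2) - 1) = \<bar>t\<bar> * sqrt (excess a t)"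
        by (simp add: excess_mult[symmetric] real_sqrt_mult)
      then show ?thesis using that by (simp add: lawlor_q_def r_sq)
    qed
    show "lawlor_angle a j s = (LBINT t=ereal 0..ereal s. ?f t)"
      unfolding lawlor_angle_def lawlor_phi_def add_0
    proof (rule interval_integral_cong)
      fix t assume "t \<in> einterval (min (ereal 0) (ereal s)) (max (ereal 0) (ereal s))"
      then have "t \<noteq> 0" by (cases "0 \<le> s") (auto simp: einterval_def)
      then show "\<bar>t\<bar> / ((1 / a j + t\<^sup>2) * sqrt ((\<Prod>k\<in>UNIV. 1 + a k * t\<^sup>2) - 1)) = ?f t"
        by (rule eq)
    qed
  qed
  define m where "m = \<bar>s\<bar> + 1"
  have "continuous_on {-m..m} ?f"
    by (rule continuous_on_subset[OF smooth_on_imp_continuous_on[OF angle_deriv_smooth]]) simp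
  then have "((\<lambda>u. LBINT t=ereal 0..ereal u. ?f t) has_vector_derivative ?f s) (at s within {-m..m})"
    by (intro interval_integral_FTC2) (auto simp: m_def)
  moreover have "(at s within {-m..m}) = at s"
    by (rule at_within_interior) (auto simp: m_def)
  ultimately show ?thesis by (simp add: angle has_real_derivative_iff_has_vector_derivative)
qed

lemma angle_smooth: "smooth_on UNIV (lawlor_angle a j)"
  using angle_deriv by (intro smooth_on_antiderivative[OF open_UNIV angle_deriv_smooth])
     (simp add: has_real_derivative_iff_has_vector_derivative)

lemma angle_0: "lawlor_angle a j 0 = 0"
  by (simp add: lawlor_angle_def lawlor_phi_def)

lemma angle_mono: "s < t \<Longrightarrow> lawlor_angle a j s < lawlor_angle a j t"
  by (rule DERIV_pos_imp_increasing[of s t]) (use angle_deriv q_pos r_pos in \<open>auto intro!: exI divide_pos_pos zero_less_power\<close>)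

text \<open>
  Let \<open>W = s \<surd>(excess a s)\<close>, so that \<open>1 + W\<^sup>2 = \<Prod>(1 + a\<^sub>k s\<^sup>2)\<close>.  Logarithmic differentiation of this
  product gives \<open>W' = (1 + W\<^sup>2) \<Sum>\<theta>\<^sub>j'\<close>, which says that \<open>arctan W\<close> and \<open>\<Sum>\<theta>\<^sub>j\<close> have equal derivatives.
  Both vanish at 0.
\<close>

lemma sum_angle: "(\<Sum>j\<in>UNIV. lawlor_angle a j s) = arctan (s * sqrt (excess a s))"
proof -
  let ?W = "\<lambda>s. s * sqrt (excess a s)"
  let ?\<Theta>' = "\<lambda>s. \<Sum>j\<in>UNIV. lawlor_q a s / (lawlor_r a j s)\<^sup>2"
  have W2: "1 + (?W s)\<^sup>2 = (\<Prod>k\<in>UNIV. 1 + a k * s\<^sup>2)" for s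
    using excess_mult[of s] excess_pos[of s] by (simp add: power_mult_distrib)
  define E' where "E' s = frechet_derivative (excess a) (at s) 1" for s
  have E': "(excess a has_real_derivative E' s) (at s)" for s
  proof (rule has_derivative_imp_has_field_derivative)
    show D: "(excess a has_derivative frechet_derivative (excess a) (at s)) (at s)"
      by (rule smooth_on_has_derivative[OF excess_smooth UNIV_I])
    show "x * E' s = frechet_derivative (excess a) (at s) x" for x
      using linear_cmul[OF has_derivative_linear[OF D], of x 1] by (simp add: E'_def)
  qed
  define W' where "W' s = sqrt (excess a s) + s * (E' s / (2 * sqrt (excess a s)))" for s
  have W': "(?W has_real_derivative W' s) (at s)" for s
  proof -
    have "((\<lambda>s. sqrt (excess a s)) has_real_derivative inverse (sqrt (excess a s)) / 2 * E' s) (at s)"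
      by (rule DERIV_chain2[OF DERIV_real_sqrt[OF excess_pos] E'])
    from DERIV_mult[OF DERIV_ident this] show ?thesis
      by (rule DERIV_cong) (simp add: W'_def field_simps)
  qed
  have W'_eq: "W' s = (1 + (?W s)\<^sup>2) * ?\<Theta>' s" for s
  \<comment> \<open>The logarithmic derivative determines \<open>W W'\<close>, so \<open>s = 0\<close>, where \<open>W = 0\<close>, is treated directly.\<close>
  proof (cases "s = 0")
    case True
    have "W' 0 = sqrt (excess a 0)" by (simp add: W'_def)
    moreover have "?\<Theta>' 0 = lawlor_q a 0 * excess a 0"
      by (simp add: r_sq excess_def sum_distrib_left)
    moreover have "lawlor_q a 0 * excess a 0 = sqrt (excess a 0)"
      using excess_pos[of 0] by (simp add: lawlor_q_def real_div_sqrt)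
    ultimately show ?thesis using True by simp
  next
    case False
    have nz: "1 + a k * s\<^sup>2 \<noteq> 0" for k
      using a_pos[of k] by (smt (verit) mult_nonneg_nonneg zero_le_power2)
    have "((\<lambda>s. 1 + (?W s)\<^sup>2) has_real_derivative 2 * ?W s * W' s) (at s)"
      by (rule has_real_derivative_one_plus_square[OF W'])
    moreover have "((\<lambda>s. \<Prod>k\<in>UNIV. 1 + a k * s\<^sup>2) has_real_derivative
        (\<Prod>k\<in>UNIV. 1 + a k * s\<^sup>2) * (\<Sum>k\<in>UNIV. 2 * a k * s / (1 + a k * s\<^sup>2))) (at s)"
      by (rule has_field_derivative_prod'[where f' = "\<lambda>k. 2 * a k * s", THEN DERIV_cong])
         (use nz in \<open>auto intro!: derivative_eq_intros\<close>)
    ultimately have "2 * ?W s * W' s = (1 + (?W s)\<^sup>2) * (\<Sum>k\<in>UNIV. 2 * a k * s / (1 + a k * s\<^sup>2))"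
      unfolding W2 using DERIV_unique by blast
    also have "(\<Sum>k\<in>UNIV. 2 * a k * s / (1 + a k * s\<^sup>2)) = 2 * ?W s * ?\<Theta>' s"
    proof -
      have "2 * a k * s / (1 + a k * s\<^sup>2) = 2 * ?W s * (lawlor_q a s / (lawlor_r a k s)\<^sup>2)" for k
      proof -
        have "lawlor_q a s * sqrt (excess a s) = 1" using excess_pos[of s] by (simp add: lawlor_q_def)
        moreover have "(lawlor_r a k s)\<^sup>2 = (1 + a k * s\<^sup>2) / a k"
          using a_pos[of k] by (simp add: r_sq field_simps)
        ultimately show ?thesis by (simp add: algebra_simps)
      qed
      then show ?thesis by (simp add: sum_distrib_left)
    qed
    finally show ?thesis using False excess_pos[of s] by simp
  qed
  have "((\<lambda>s. arctan (?W s) - (\<Sum>j\<in>UNIV. lawlor_angle a j s)) has_real_derivative 0) (at s)" for s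
  proof -
    have "inverse (1 + (?W s)\<^sup>2) * W' s - ?\<Theta>' s = 0"
      using W'_eq[of s] by (simp add: add_nonneg_eq_0_iff)
    moreover have "((\<lambda>s. arctan (?W s) - (\<Sum>j\<in>UNIV. lawlor_angle a j s)) has_real_derivative
        inverse (1 + (?W s)\<^sup>2) * W' s - ?\<Theta>' s) (at s)"
      by (intro DERIV_diff DERIV_sum angle_deriv DERIV_chain2[OF DERIV_arctan W'])
    ultimately show ?thesis by simp
  qed
  from DERIV_isconst_all[OF allI[OF this], of s 0] show ?thesis by (simp add: angle_0)
qed

text \<open>
  The angles all have the sign of \<open>s\<close>, so each is bounded by the absolute value of their sum, which is
  an arctangent.
\<close>

lemma angle_bounds: "\<bar>lawlor_angle a j s\<bar> < pi / 2"
proof -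
  have sgn: "s \<ge> 0 \<Longrightarrow> lawlor_angle a k s \<ge> 0" "s \<le> 0 \<Longrightarrow> lawlor_angle a k s \<le> 0" for k
    using angle_mono[of 0 s k] angle_mono[of s 0 k] angle_0[of k] by (cases "s = 0"; simp)+
  have "\<bar>lawlor_angle a j s\<bar> \<le> (\<Sum>k\<in>UNIV. \<bar>lawlor_angle a k s\<bar>)"
    by (rule member_le_sum) auto
  also have "\<dots> = \<bar>\<Sum>k\<in>UNIV. lawlor_angle a k s\<bar>"
  proof (cases "s \<ge> 0")
    case True
    then show ?thesis using sgn(1) by (simp add: sum_nonneg)
  next
    case False
    then have "lawlor_angle a k s \<le> 0" for k using sgn(2) by simp
    then show ?thesis by (simp add: sum_nonpos sum_negf abs_of_nonpos)
  qed
  also have "\<dots> < pi / 2"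
    unfolding sum_angle using arctan_bounded[of "s * sqrt (excess a s)"] by linarith
  finally show ?thesis .
qed

lemma cos_angle_pos: "cos (lawlor_angle a j s) > 0"
  using angle_bounds[of j s] by (intro cos_gt_zero_pi) auto

text \<open>
  The tangent of the angle of \<open>exp(-i\<psi>\<^sub>j) z\<^sub>j\<close> at a point of \<open>L\<close> with \<open>x\<^sub>j \<noteq> 0\<close>.  A change of sign of \<open>x\<^sub>j\<close>
  does not affect it.
\<close>

definition slope :: "'n \<Rightarrow> real \<Rightarrow> real" where
  "slope j s = tan (lawlor_angle a j s)"

definition slope_inv :: "'n \<Rightarrow> real \<Rightarrow> real" where
  "slope_inv j = inv (slope j)"

lemma slope_inv_slope: "slope_inv j (slope j s) = s"
proof -
  have "slope j s < slope j t" if "s < t" for s t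
    unfolding slope_def using angle_bounds[of j s] angle_bounds[of j t] angle_mono[OF that, of j]
    by (intro tan_monotone) auto
  then have "inj (slope j)" by (metis injI linorder_neqE order_less_irrefl)
  then show ?thesis by (simp add: slope_inv_def)
qed

lemma slope_inv_smooth: "smooth_on (range (slope j)) (slope_inv j)"
proof (rule smooth_on_inverse_function[where f' =
    "\<lambda>s. inverse ((cos (lawlor_angle a j s))\<^sup>2) * (lawlor_q a s / (lawlor_r a j s)\<^sup>2)"])
  show "smooth_on UNIV (\<lambda>s. inverse ((cos (lawlor_angle a j s))\<^sup>2) * (lawlor_q a s / (lawlor_r a j s)\<^sup>2))"
    by (intro smooth_on_mult smooth_on_inverse smooth_on_power2 smooth_on_cos angle_smooth angle_deriv_smooth)
       (simp add: less_imp_neq[OF cos_angle_pos, symmetric])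
  show "(slope j has_real_derivative
      inverse ((cos (lawlor_angle a j s))\<^sup>2) * (lawlor_q a s / (lawlor_r a j s)\<^sup>2)) (at s)" for s
    unfolding slope_def[abs_def]
    by (rule DERIV_chain2[OF DERIV_tan angle_deriv]) (simp add: less_imp_neq[OF cos_angle_pos, symmetric])
  show "inverse ((cos (lawlor_angle a j s))\<^sup>2) * (lawlor_q a s / (lawlor_r a j s)\<^sup>2) > 0" for s
    using cos_angle_pos[of j s] q_pos[of s] r_pos[of j s] by simp
qed (rule slope_inv_slope)

end

section \<open>The parametrization and its smooth inverse\<close>

context lawlor_parameters
begin

definition lawlor_map :: "(real ^ 'n) \<times> real \<Rightarrow> complex ^ 'n" where
  "lawlor_map p = (\<chi> j. complex_of_real (fst p $ j * lawlor_r a j (snd p))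
                        * exp (\<i> * complex_of_real (lawlor_phi a \<psi> j (snd p))))"

lemma lawlor_eq_image: "lawlor a \<psi> = lawlor_map ` (sphere 0 1 \<times> UNIV)"
proof (intro equalityI subsetI)
  fix z assume "z \<in> lawlor a \<psi>"
  then obtain x :: "'n \<Rightarrow> real" and s where "(\<Sum>j\<in>UNIV. (x j)\<^sup>2) = 1"
    "z = (\<chi> j. complex_of_real (x j * lawlor_r a j s) * exp (\<i> * complex_of_real (lawlor_phi a \<psi> j s)))"
    unfolding lawlor_def by blast
  then have "z = lawlor_map (\<chi> j. x j, s)" "(\<chi> j. x j) \<in> sphere 0 1"
    by (simp_all only: lawlor_map_def sphere_iff_sum_squares vec_lambda_beta fst_conv snd_conv)
  then show "z \<in> lawlor_map ` (sphere 0 1 \<times> UNIV)" by blast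
next
  fix z assume "z \<in> lawlor_map ` (sphere 0 1 \<times> UNIV)"
  then obtain x s where "x \<in> sphere 0 1" "z = lawlor_map (x, s)" by blast
  then show "z \<in> lawlor a \<psi>"
    unfolding lawlor_def lawlor_map_def fst_conv snd_conv sphere_iff_sum_squares by blast
qed

lemma lawlor_map_smooth: "smooth_on UNIV lawlor_map"
proof -
  have "smooth_on UNIV (\<lambda>p::(real ^ 'n) \<times> real. complex_of_real (fst p $ j * lawlor_r a j (snd p))
                        * exp (\<i> * complex_of_real (lawlor_phi a \<psi> j (snd p))))" for j
    unfolding lawlor_phi_eq
    by (intro smooth_on_mult smooth_on_linear[OF bounded_linear_of_real] smooth_on_exp_i smooth_on_add
          smooth_on_const smooth_on_compose[OF r_smooth] smooth_on_compose[OF angle_smooth]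
          smooth_on_linear[OF bounded_linear_vec_nth] smooth_on_linear[OF bounded_linear_fst]
          smooth_on_linear[OF bounded_linear_snd] smooth_on_id) auto
  then show ?thesis unfolding lawlor_map_def[abs_def] by (intro smooth_on_vec) auto
qed

text \<open>
  The parametrization is proper; this gives closedness below.
\<close>

lemma abs_le_norm_lawlor_map:
  assumes "x \<in> sphere 0 1"
  shows "\<bar>s\<bar> \<le> norm (lawlor_map (x, s))"
proof -
  have "(norm (lawlor_map (x, s)))\<^sup>2 = (\<Sum>j\<in>UNIV. (cmod (lawlor_map (x, s) $ j))\<^sup>2)"
    by (simp add: norm_vec_def L2_set_def sum_nonneg)
  also have "\<dots> = (\<Sum>j\<in>UNIV. (x $ j)\<^sup>2 * (1 / a j + s\<^sup>2))"
  proof (rule sum.cong[OF refl])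
    fix j
    have "cmod (lawlor_map (x, s) $ j) = \<bar>x $ j\<bar> * lawlor_r a j s"
      using r_pos[of j s] by (simp add: lawlor_map_def norm_mult)
    then show "(cmod (lawlor_map (x, s) $ j))\<^sup>2 = (x $ j)\<^sup>2 * (1 / a j + s\<^sup>2)"
      by (simp only: power_mult_distrib r_sq power2_abs)
  qed
  also have "\<dots> \<ge> (\<Sum>j\<in>UNIV. (x $ j)\<^sup>2 * s\<^sup>2)"
    using a_pos by (intro sum_mono mult_left_mono) (auto simp: less_imp_le)
  also have "(\<Sum>j\<in>UNIV. (x $ j)\<^sup>2 * s\<^sup>2) = s\<^sup>2"
    using assms unfolding sphere_iff_sum_squares by (simp add: sum_distrib_right[symmetric])
  finally have "\<bar>s\<bar>\<^sup>2 \<le> (norm (lawlor_map (x, s)))\<^sup>2" by simp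
  then show ?thesis by (rule power2_le_imp_le) simp
qed

lemma closed_lawlor: "closed (lawlor a \<psi>)"
  unfolding closed_sequential_limits
proof (intro allI impI, elim conjE)
  fix z p assume z: "\<forall>n. z n \<in> lawlor a \<psi>" and lim: "z \<longlonglongrightarrow> p"
  define K where "K = lawlor_map ` (sphere 0 1 \<times> {- (norm p + 1) .. norm p + 1})"
  have "compact K"
    unfolding K_def
    by (intro compact_continuous_image compact_Times compact_sphere compact_Icc
          continuous_on_subset[OF smooth_on_imp_continuous_on[OF lawlor_map_smooth]]) auto
  have "eventually (\<lambda>n. norm (z n) < norm p + 1) sequentially"
    by (rule order_tendstoD(2)[OF tendsto_norm[OF lim]]) simp
  then have "eventually (\<lambda>n. z n \<in> K) sequentially"
  proof (eventually_elim)
    case (elim n)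
    obtain x s where xs: "x \<in> sphere 0 1" "z n = lawlor_map (x, s)"
      using z lawlor_eq_image by blast
    then have "\<bar>s\<bar> < norm p + 1" using abs_le_norm_lawlor_map[OF xs(1), of s] elim by simp
    then show ?case using xs unfolding K_def by (intro image_eqI[of _ _ "(x, s)"]) auto
  qed
  then have "p \<in> K"
    using Lim_in_closed_set[OF compact_imp_closed[OF \<open>compact K\<close>] _ _ lim] by simp
  then show "p \<in> lawlor a \<psi>" unfolding K_def lawlor_eq_image by blast
qed

definition untwist :: "'n \<Rightarrow> complex ^ 'n \<Rightarrow> complex" where
  "untwist j z = exp (- (\<i> * complex_of_real (\<psi> j))) * z $ j"

lemma untwist_lawlor_map:
  "untwist j (lawlor_map (x, s)) =
     complex_of_real (x $ j * lawlor_r a j s) * exp (\<i> * complex_of_real (lawlor_angle a j s))"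
proof -
  have "exp (- (\<i> * complex_of_real (\<psi> j))) * exp (\<i> * complex_of_real (lawlor_phi a \<psi> j s))
      = exp (\<i> * complex_of_real (lawlor_angle a j s))"
    by (simp add: lawlor_phi_eq exp_add[symmetric] algebra_simps)
  then show ?thesis by (simp add: untwist_def lawlor_map_def algebra_simps)
qed

lemma Re_untwist_lawlor_map:
    "Re (untwist j (lawlor_map (x, s))) = x $ j * lawlor_r a j s * cos (lawlor_angle a j s)"
  and Im_untwist_lawlor_map:
    "Im (untwist j (lawlor_map (x, s))) = x $ j * lawlor_r a j s * sin (lawlor_angle a j s)"
  by (simp_all add: untwist_lawlor_map exp_Euler sin_of_real cos_of_real)

lemma bounded_linear_untwist: "bounded_linear (untwist j)"
  unfolding untwist_def[abs_def]
  by (intro bounded_linear_compose[OF bounded_linear_mult_right] bounded_linear_vec_nth)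

text \<open>
  Where the \<open>j\<close>-th coordinate has a slope that occurs on \<open>L\<close>, that slope determines \<open>s\<close>, and the real
  parts then determine \<open>x\<close>.  The resulting map \<open>coords j\<close> is defined and smooth on an open
  subset of \<open>\<complex>\<^sup>n\<close>, as an extension of the inverse of the parametrization.
\<close>

definition coords_domain :: "'n \<Rightarrow> (complex ^ 'n) set" where
  "coords_domain j = {z. Re (untwist j z) \<noteq> 0} \<inter>
     (\<lambda>z. Im (untwist j z) / Re (untwist j z)) -` range (slope j)"

definition coords_s :: "'n \<Rightarrow> complex ^ 'n \<Rightarrow> real" where
  "coords_s j z = slope_inv j (Im (untwist j z) / Re (untwist j z))"

definition coords :: "'n \<Rightarrow> complex ^ 'n \<Rightarrow> (real ^ 'n) \<times> real" where
  "coords j z =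
     (\<chi> k. Re (untwist k z) / (lawlor_r a k (coords_s j z) * cos (lawlor_angle a k (coords_s j z))),
      coords_s j z)"

lemma smooth_on_Re_untwist: "open U \<Longrightarrow> smooth_on U (\<lambda>z. Re (untwist j z))"
  and smooth_on_Im_untwist: "open U \<Longrightarrow> smooth_on U (\<lambda>z. Im (untwist j z))"
  by (intro smooth_on_linear[OF bounded_linear_Re] smooth_on_linear[OF bounded_linear_Im]
        smooth_on_linear[OF bounded_linear_untwist] smooth_on_id; assumption)+

lemma open_Re_untwist_pos: "open {z. 0 < c * Re (untwist j z)}"
  and open_Re_untwist_nonzero: "open {z. Re (untwist j z) \<noteq> 0}"
  using linear_continuous_on[OF bounded_linear_untwist]
  by (auto intro!: open_Collect_less open_Collect_neq continuous_intros)

lemma open_coords_domain: "open (coords_domain j)"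
  unfolding coords_domain_def
  by (rule continuous_open_preimage[OF smooth_on_imp_continuous_on[OF smooth_on_divide]])
     (auto intro: smooth_on_Re_untwist smooth_on_Im_untwist open_Re_untwist_nonzero
        smooth_on_open[OF slope_inv_smooth])

lemma coords_smooth: "smooth_on (coords_domain j) (coords j)"
proof -
  have s: "smooth_on (coords_domain j) (coords_s j)"
    unfolding coords_s_def[abs_def]
    by (rule smooth_on_compose[OF slope_inv_smooth smooth_on_divide],
        intro smooth_on_Im_untwist open_coords_domain, intro smooth_on_Re_untwist open_coords_domain)
       (auto simp: coords_domain_def)
  have "smooth_on (coords_domain j) (\<lambda>z. Re (untwist k z) /
          (lawlor_r a k (coords_s j z) * cos (lawlor_angle a k (coords_s j z))))" for k
    by (intro smooth_on_divide smooth_on_mult smooth_on_cos smooth_on_compose[OF r_smooth s]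
         smooth_on_compose[OF angle_smooth s] smooth_on_Re_untwist open_coords_domain)
       (auto simp: less_imp_neq[OF r_pos, symmetric] less_imp_neq[OF cos_angle_pos, symmetric])
  then show ?thesis
    unfolding coords_def[abs_def] by (intro smooth_on_Pair s smooth_on_vec open_coords_domain)
qed

text \<open>
  The left-hand side depends on the point of \<open>L\<close> only.  Hence two parameter pairs of the same point have
  nonzero \<open>j\<close>-th coordinate simultaneously and are both recovered by \<open>coords j\<close>, which gives injectivity.
\<close>

lemma lawlor_map_in_coords_domain: "lawlor_map (x, s) \<in> coords_domain j \<longleftrightarrow> x $ j \<noteq> 0"
  using r_pos[of j s] cos_angle_pos[of j s]
  by (auto simp: coords_domain_def Re_untwist_lawlor_map Im_untwist_lawlor_map slope_def tan_def)

lemma coords_lawlor_map: "x $ j \<noteq> 0 \<Longrightarrow> coords j (lawlor_map (x, s)) = (x, s)"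
proof -
  assume "x $ j \<noteq> 0"
  then have "coords_s j (lawlor_map (x, s)) = slope_inv j (slope j s)"
    using r_pos[of j s] cos_angle_pos[of j s]
    by (simp add: coords_s_def Re_untwist_lawlor_map Im_untwist_lawlor_map slope_def tan_def)
  then show ?thesis
    by (simp add: coords_def slope_inv_slope Re_untwist_lawlor_map vec_eq_iff
        less_imp_neq[OF r_pos, symmetric] less_imp_neq[OF cos_angle_pos, symmetric])
qed

lemma inj_on_lawlor_map: "inj_on lawlor_map (sphere 0 1 \<times> UNIV)"
proof (rule inj_onI, clarify)
  fix x y :: "real ^ 'n" and s t
  assume "x \<in> sphere 0 1" and eq: "lawlor_map (x, s) = lawlor_map (y, t)"
  then obtain j where j: "x $ j \<noteq> 0" using unit_vector_nonzero_coordinate by blast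
  then have "y $ j \<noteq> 0" using eq lawlor_map_in_coords_domain by metis
  then show "x = y \<and> s = t" using j eq coords_lawlor_map by (metis prod.inject)
qed

lemma diffeomorphic_lawlor:
  "diffeomorphic ((sphere 0 1 :: (real ^ 'n) set) \<times> (UNIV :: real set)) (lawlor a \<psi>)"
  unfolding diffeomorphic_def
proof (intro exI conjI ballI)
  let ?M = "(sphere 0 1 :: (real ^ 'n) set) \<times> (UNIV :: real set)"
  let ?g = "the_inv_into ?M lawlor_map"
  have g: "?g (lawlor_map p) = p" if "p \<in> ?M" for p
    using the_inv_into_f_f[OF inj_on_lawlor_map that] .
  show "smooth_map_on ?M lawlor_map"
    unfolding smooth_map_on_def using lawlor_map_smooth by blast
  show "smooth_map_on (lawlor a \<psi>) ?g"
    unfolding smooth_map_on_def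
  proof
    fix p assume "p \<in> lawlor a \<psi>"
    then obtain x s where x: "x \<in> sphere 0 1" and p: "p = lawlor_map (x, s)"
      unfolding lawlor_eq_image by blast
    obtain j where j: "x $ j \<noteq> 0" using unit_vector_nonzero_coordinate[OF x] .
    have "coords j z = ?g z" if z: "z \<in> coords_domain j \<inter> lawlor a \<psi>" for z
    proof -
      obtain y t where y: "y \<in> sphere 0 1" "z = lawlor_map (y, t)"
        using z unfolding lawlor_eq_image by blast
      then have "y $ j \<noteq> 0" using z lawlor_map_in_coords_domain by blast
      then have "coords j z = (y, t)" using y coords_lawlor_map by simp
      moreover have "?g z = (y, t)" unfolding y(2) by (rule g) (use y(1) in simp)
      ultimately show ?thesis by simp
    qed
    moreover have "p \<in> coords_domain j" using p j lawlor_map_in_coords_domain by simp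
    ultimately show "\<exists>U g. p \<in> U \<and> smooth_on U g \<and> (\<forall>x\<in>U \<inter> lawlor a \<psi>. g x = ?g x)"
      using coords_smooth by blast
  qed
  show "lawlor_map ` ?M = lawlor a \<psi>" by (rule lawlor_eq_image[symmetric])
  show "?g ` lawlor a \<psi> = ?M" unfolding lawlor_eq_image by (rule the_inv_into_onto[OF inj_on_lawlor_map])
  show "?g (lawlor_map p) = p" if "p \<in> ?M" for p using g that .
  show "lawlor_map (?g z) = z" if "z \<in> lawlor a \<psi>" for z
    using that unfolding lawlor_eq_image by (rule f_the_inv_into_f[OF inj_on_lawlor_map])
qed

text \<open>
  The open hemisphere where \<open>x\<^sub>j\<close> has the sign of \<open>c = \<plusminus>1\<close> is a graph over the other coordinates.  The
  vacant \<open>j\<close>-th coordinate of the chart carries \<open>s\<close>, so that hemisphere times \<open>\<real>\<close> is parametrized by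
  an open subset of \<open>\<real>\<^sup>n\<close> for the same index type.
\<close>

definition graph_map :: "'n \<Rightarrow> real \<Rightarrow> real ^ 'n \<Rightarrow> (real ^ 'n) \<times> real" where
  "graph_map j c u = (\<chi> k. if k = j then c * sqrt (1 - (\<Sum>i\<in>UNIV - {j}. (u $ i)\<^sup>2)) else u $ k, u $ j)"

definition graph_proj :: "'n \<Rightarrow> (real ^ 'n) \<times> real \<Rightarrow> real ^ 'n" where
  "graph_proj j p = (\<chi> k. if k = j then snd p else fst p $ k)"

lemma graph_proj_smooth: "smooth_on UNIV (graph_proj j)"
  unfolding graph_proj_def[abs_def]
proof (intro smooth_on_vec open_UNIV)
  show "smooth_on UNIV (\<lambda>p::(real ^ 'n) \<times> real. if k = j then snd p else fst p $ k)" for k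
    by (cases "k = j") (auto intro!: smooth_on_linear[OF bounded_linear_snd]
         smooth_on_linear[OF bounded_linear_vec_nth] smooth_on_linear[OF bounded_linear_fst] smooth_on_id)
qed

lemma graph_proj_graph_map: "graph_proj j (graph_map j c u) = u"
  by (simp add: graph_proj_def graph_map_def vec_eq_iff)

definition graph_domain :: "'n \<Rightarrow> (real ^ 'n) set" where
  "graph_domain j = {u. (\<Sum>i\<in>UNIV - {j}. (u $ i)\<^sup>2) < 1}"

lemma open_graph_domain: "open (graph_domain j)"
  unfolding graph_domain_def by (intro open_Collect_less continuous_intros)

lemma graph_map_smooth: "smooth_on (graph_domain j) (graph_map j c)"
  unfolding graph_map_def[abs_def]
proof (intro smooth_on_Pair smooth_on_vec open_graph_domain)
  have comp: "smooth_on (graph_domain j) (\<lambda>u. u $ k)" for k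
    by (intro smooth_on_linear[OF bounded_linear_vec_nth] smooth_on_id open_graph_domain)
  then show "smooth_on (graph_domain j) (\<lambda>u. u $ j)" .
  have "smooth_on (graph_domain j) (\<lambda>u. c * sqrt (1 - (\<Sum>i\<in>UNIV - {j}. (u $ i)\<^sup>2)))"
    by (intro smooth_on_mult smooth_on_const smooth_on_sqrt smooth_on_diff smooth_on_sum
          smooth_on_power2 comp open_graph_domain) (simp add: graph_domain_def)
  then show "smooth_on (graph_domain j)
      (\<lambda>u. if k = j then c * sqrt (1 - (\<Sum>i\<in>UNIV - {j}. (u $ i)\<^sup>2)) else u $ k)" for k
    using comp by (cases "k = j") auto
qed

lemma sum_UNIV_remove: "(\<Sum>i\<in>UNIV. f i) = f j + (\<Sum>i\<in>UNIV - {j}. f i)" for f :: "'n \<Rightarrow> real"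
  by (simp add: sum.remove)

lemma graph_map_in_sphere:
  assumes "u \<in> graph_domain j" "\<bar>c\<bar> = 1"
  shows "fst (graph_map j c u) \<in> sphere 0 1"
proof -
  have "c\<^sup>2 = 1" using assms(2) by (metis power2_abs one_power2)
  then show ?thesis using assms(1)
    unfolding sphere_iff_sum_squares sum_UNIV_remove[of _ j]
    by (simp add: graph_map_def graph_domain_def power_mult_distrib)
qed

lemma graph_map_graph_proj:
  assumes "x \<in> sphere 0 1" "\<bar>c\<bar> = 1" "0 < c * x $ j"
  shows "graph_map j c (graph_proj j (x, s)) = (x, s)" "graph_proj j (x, s) \<in> graph_domain j"
proof -
  have "(\<Sum>i\<in>UNIV - {j}. (graph_proj j (x, s) $ i)\<^sup>2) = (\<Sum>i\<in>UNIV - {j}. (x $ i)\<^sup>2)"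
    by (intro sum.cong) (auto simp: graph_proj_def)
  also have "\<dots> = 1 - (x $ j)\<^sup>2"
    using assms(1) unfolding sphere_iff_sum_squares sum_UNIV_remove[of _ j] by simp
  finally have sum: "(\<Sum>i\<in>UNIV - {j}. (graph_proj j (x, s) $ i)\<^sup>2) = 1 - (x $ j)\<^sup>2" .
  have "c * \<bar>x $ j\<bar> = x $ j"
    using assms(2,3) by (auto simp: abs_if split: if_splits)
  then show "graph_map j c (graph_proj j (x, s)) = (x, s)"
    unfolding graph_map_def sum by (auto simp: graph_proj_def vec_eq_iff)
  show "graph_proj j (x, s) \<in> graph_domain j"
    using sum assms(3) by (auto simp: graph_domain_def)
qed

text \<open>
  The chart is the parametrization composed with a hemisphere graph.  It has the smooth left inverse
  \<open>graph_proj j \<circ> coords j\<close>, defined on an open set of \<open>\<complex>\<^sup>n\<close>; this gives at once that it is an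
  immersion and a homeomorphism onto its image.
\<close>

lemma half_dim_submanifold_lawlor: "half_dim_submanifold (lawlor a \<psi>)"
  unfolding half_dim_submanifold_def
proof
  fix p assume "p \<in> lawlor a \<psi>"
  then obtain x0 s0 where x0: "x0 \<in> sphere 0 1" and p: "p = lawlor_map (x0, s0)"
    unfolding lawlor_eq_image by blast
  obtain j where j: "x0 $ j \<noteq> 0" using unit_vector_nonzero_coordinate[OF x0] .
  define c where "c = sgn (x0 $ j)"
  have c: "\<bar>c\<bar> = 1" using j by (simp add: c_def)
  define U where "U = {z. 0 < c * Re (untwist j z)}"
  define f where "f u = lawlor_map (graph_map j c u)" for u
  define g where "g z = graph_proj j (coords j z)" for z
  have mem_U: "lawlor_map (x, s) \<in> U \<longleftrightarrow> 0 < c * x $ j" for x s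
  proof -
    have "c * Re (untwist j (lawlor_map (x, s)))
        = (c * x $ j) * (lawlor_r a j s * cos (lawlor_angle a j s))"
      by (simp add: Re_untwist_lawlor_map)
    moreover have "0 < lawlor_r a j s * cos (lawlor_angle a j s)"
      by (rule mult_pos_pos[OF r_pos cos_angle_pos])
    moreover have "0 < A * B \<longleftrightarrow> 0 < A" if "0 < B" for A B :: real
      using that by (simp add: zero_less_mult_iff)
    ultimately show ?thesis by (simp only: U_def mem_Collect_eq)
  qed
  have pos: "0 < c * fst (graph_map j c u) $ j" if "u \<in> graph_domain j" for u
  proof -
    have "c * fst (graph_map j c u) $ j = \<bar>c\<bar>\<^sup>2 * sqrt (1 - (\<Sum>i\<in>UNIV - {j}. (u $ i)\<^sup>2))"
      by (simp add: graph_map_def power2_eq_square)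
    then show ?thesis using that c by (simp add: graph_domain_def)
  qed
  have fs: "smooth_on (graph_domain j) f"
    unfolding f_def by (rule smooth_on_compose[OF lawlor_map_smooth graph_map_smooth]) simp
  have f_mem: "f u \<in> U \<inter> lawlor a \<psi>" if "u \<in> graph_domain j" for u
  proof -
    obtain x s where xs: "graph_map j c u = (x, s)" by fastforce
    then have "0 < c * x $ j" "x \<in> sphere 0 1"
      using pos[OF that] graph_map_in_sphere[OF that c] by simp_all
    then show ?thesis by (auto simp: f_def xs mem_U lawlor_eq_image)
  qed
  have f_dom: "f u \<in> coords_domain j" and gf: "g (f u) = u" if "u \<in> graph_domain j" for u
  proof -
    obtain x s where xs: "graph_map j c u = (x, s)" by fastforce
    then have "x $ j \<noteq> 0" using pos[OF that] by auto
    then show "f u \<in> coords_domain j" "g (f u) = u"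
      using graph_proj_graph_map[of j c u]
      by (simp_all add: f_def g_def xs lawlor_map_in_coords_domain coords_lawlor_map)
  qed
  have gs: "smooth_on (coords_domain j) g"
    unfolding g_def by (rule smooth_on_compose[OF graph_proj_smooth coords_smooth]) simp
  have fg: "f (g z) = z" and g_mem: "g z \<in> graph_domain j" and z_dom: "z \<in> coords_domain j"
    if z: "z \<in> U \<inter> lawlor a \<psi>" for z
  proof -
    obtain x s where x: "x \<in> sphere 0 1" "z = lawlor_map (x, s)"
      using z unfolding lawlor_eq_image by blast
    then have cx: "0 < c * x $ j" using z mem_U by blast
    then have xj: "x $ j \<noteq> 0" by auto
    show "z \<in> coords_domain j" "f (g z) = z" "g z \<in> graph_domain j"
      using graph_map_graph_proj[OF x(1) c cx] xj x(2)
      by (simp_all add: f_def g_def coords_lawlor_map lawlor_map_in_coords_domain)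
  qed
  show "\<exists>U (V :: (real ^ 'n) set) f g. open U \<and> p \<in> U \<and> smooth_on V f \<and>
        (\<forall>u\<in>V. inj (frechet_derivative f (at u))) \<and> homeomorphism V (U \<inter> lawlor a \<psi>) f g"
  proof (intro exI conjI ballI)
    show "open U" unfolding U_def by (rule open_Re_untwist_pos)
    show "p \<in> U" unfolding p mem_U using j by (cases "0 < x0 $ j") (auto simp: c_def)
    show "smooth_on (graph_domain j) f" by (rule fs)
    show "inj (frechet_derivative f (at u))" if u: "u \<in> graph_domain j" for u
    proof -
      let ?f' = "frechet_derivative f (at u)" and ?g' = "frechet_derivative g (at (f u))"
      have "((\<lambda>u. g (f u)) has_derivative (\<lambda>v. ?g' (?f' v))) (at u)"
        by (rule has_derivative_compose[OF smooth_on_has_derivative[OF fs u]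
              smooth_on_has_derivative[OF gs f_dom[OF u]]])
      then have "((\<lambda>u. u) has_derivative (\<lambda>v. ?g' (?f' v))) (at u)"
        by (rule has_derivative_transform_within_open[OF _ open_graph_domain u]) (rule gf)
      then have "(\<lambda>v. ?g' (?f' v)) = (\<lambda>v. v)"
        using has_derivative_unique has_derivative_ident by blast
      then show ?thesis by (metis injI)
    qed
    show "homeomorphism (graph_domain j) (U \<inter> lawlor a \<psi>) f g"
    proof (rule homeomorphismI)
      show "continuous_on (graph_domain j) f" by (rule smooth_on_imp_continuous_on[OF fs])
      show "continuous_on (U \<inter> lawlor a \<psi>) g"
        by (rule continuous_on_subset[OF smooth_on_imp_continuous_on[OF gs]]) (use z_dom in blast)
    qed (use f_mem g_mem gf fg in auto)
  qed
qed

section \<open>Tangent vectors\<close>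

text \<open>
  The derivative of \<open>lawlor_map\<close> at \<open>(x, s)\<close> in the direction \<open>(\<xi>, \<sigma>)\<close>; see \<open>lawlor_map_deriv\<close>.
\<close>

definition tangent_vec :: "real ^ 'n \<Rightarrow> real \<Rightarrow> real ^ 'n \<Rightarrow> real \<Rightarrow> complex ^ 'n" where
  "tangent_vec x s \<xi> \<sigma> = (\<chi> j. (complex_of_real (\<xi> $ j * lawlor_r a j s)
       + complex_of_real (\<sigma> * x $ j / lawlor_r a j s) * Complex s (lawlor_q a s))
       * exp (\<i> * complex_of_real (lawlor_phi a \<psi> j s)))"

lemma lawlor_map_deriv:
  assumes "(X has_vector_derivative \<xi>) (at t)" "(S has_real_derivative \<sigma>) (at t)"
  shows "((\<lambda>t. lawlor_map (X t, S t)) has_vector_derivative tangent_vec (X t) (S t) \<xi> \<sigma>) (at t)"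
  unfolding lawlor_map_def tangent_vec_def fst_conv snd_conv
proof (rule has_vector_derivative_vec)
  fix j
  let ?r = "lawlor_r a j (S t)" and ?e = "exp (\<i> * complex_of_real (lawlor_phi a \<psi> j (S t)))"
  have X: "((\<lambda>t. X t $ j) has_real_derivative \<xi> $ j) (at t)"
    using bounded_linear.has_vector_derivative[OF bounded_linear_vec_nth assms(1)]
    by (simp add: has_real_derivative_iff_has_vector_derivative)
  have "((\<lambda>t. X t $ j * lawlor_r a j (S t)) has_real_derivative
      \<xi> $ j * ?r + S t / ?r * \<sigma> * X t $ j) (at t)"
    by (rule DERIV_mult[OF X DERIV_chain2[OF r_deriv assms(2)]])
  then have 1: "((\<lambda>t. complex_of_real (X t $ j * lawlor_r a j (S t))) has_vector_derivative
      complex_of_real (\<xi> $ j * ?r + S t / ?r * \<sigma> * X t $ j)) (at t)"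
    by (rule has_vector_derivative_of_real)
  have "((\<lambda>t. lawlor_phi a \<psi> j (S t)) has_real_derivative 0 + lawlor_q a (S t) / ?r\<^sup>2 * \<sigma>) (at t)"
    unfolding lawlor_phi_eq by (rule DERIV_add[OF DERIV_const DERIV_chain2[OF angle_deriv assms(2)]])
  from has_vector_derivative_of_real[OF this]
  have "((\<lambda>t. complex_of_real (lawlor_phi a \<psi> j (S t))) has_vector_derivative
      complex_of_real (lawlor_q a (S t) / ?r\<^sup>2 * \<sigma>)) (at t)"
    by (simp only: add_0_left)
  from field_vector_diff_chain_at[OF bounded_linear.has_vector_derivative[OF bounded_linear_mult_right this] DERIV_exp]
  have 2: "((\<lambda>t. exp (\<i> * complex_of_real (lawlor_phi a \<psi> j (S t)))) has_vector_derivative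
      \<i> * complex_of_real (lawlor_q a (S t) / ?r\<^sup>2 * \<sigma>) * ?e) (at t)"
    by (simp add: o_def)
  have "complex_of_real (X t $ j * ?r) * (\<i> * complex_of_real (lawlor_q a (S t) / ?r\<^sup>2 * \<sigma>) * ?e)
      + complex_of_real (\<xi> $ j * ?r + S t / ?r * \<sigma> * X t $ j) * ?e
    = (complex_of_real (\<xi> $ j * ?r)
       + complex_of_real (\<sigma> * X t $ j / ?r) * Complex (S t) (lawlor_q a (S t))) * ?e"
    using r_pos[of j "S t"]
    by (simp add: Complex_eq field_simps power2_eq_square)
  with has_vector_derivative_mult[OF 1 2]
  show "((\<lambda>t. complex_of_real (X t $ j * lawlor_r a j (S t)) *
           exp (\<i> * complex_of_real (lawlor_phi a \<psi> j (S t)))) has_vector_derivative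
      (complex_of_real (\<xi> $ j * ?r)
       + complex_of_real (\<sigma> * X t $ j / ?r) * Complex (S t) (lawlor_q a (S t))) * ?e) (at t)"
    by simp
qed

text \<open>
  The curve \<open>(x + t\<xi>) / \<bar>x + t\<xi>\<bar>\<close> on the sphere has velocity \<open>\<xi>\<close> at \<open>t = 0\<close>, because
  \<open>\<bar>x + t\<xi>\<bar> = \<surd>(1 + t\<^sup>2 \<bar>\<xi>\<bar>\<^sup>2)\<close> is stationary there.
\<close>

lemma tangent_vec_in_tangent_space:
  assumes x: "x \<in> sphere 0 1" and \<xi>: "x \<bullet> \<xi> = 0"
  shows "tangent_vec x s \<xi> \<sigma> \<in> tangent_space (lawlor a \<psi>) (lawlor_map (x, s))"
proof -
  define N where "N t = sqrt (1 + t\<^sup>2 * (\<xi> \<bullet> \<xi>))" for t :: real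
  define X where "X t = inverse (N t) *\<^sub>R (x + t *\<^sub>R \<xi>)" for t
  have pos: "1 + t\<^sup>2 * (\<xi> \<bullet> \<xi>) > 0" for t :: real
    by (simp add: add_pos_nonneg)
  have N_pos: "N t > 0" for t unfolding N_def using pos by simp
  have "norm (x + t *\<^sub>R \<xi>) = N t" for t
  proof -
    have "x \<bullet> x = 1" using x by (simp add: norm_eq_1)
    then have "(x + t *\<^sub>R \<xi>) \<bullet> (x + t *\<^sub>R \<xi>) = 1 + t\<^sup>2 * (\<xi> \<bullet> \<xi>)"
      using \<xi> by (simp add: inner_add inner_commute power2_eq_square)
    then show ?thesis by (simp add: norm_eq_sqrt_inner N_def)
  qed
  then have X_sphere: "X t \<in> sphere 0 1" for t
    using N_pos[of t] by (simp add: X_def)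
  have N_smooth: "smooth_on UNIV N"
    unfolding N_def by (intro smooth_on_sqrt smooth_on_add smooth_on_mult smooth_on_power2
        smooth_on_const smooth_on_id pos open_UNIV)
  have X_smooth: "smooth_on UNIV X"
    unfolding X_def
    by (intro smooth_on_scaleR smooth_on_inverse N_smooth smooth_on_add smooth_on_const smooth_on_id open_UNIV)
       (simp add: less_imp_neq[OF N_pos, symmetric])
  have N0: "N 0 = 1" by (simp add: N_def)
  have "(N has_real_derivative 0) (at 0)"
    unfolding N_def by (auto intro!: derivative_eq_intros)
  then have "((\<lambda>t. inverse (N t)) has_real_derivative 0) (at 0)"
    by (auto intro!: derivative_eq_intros simp: N0)
  moreover have "((\<lambda>t. x + t *\<^sub>R \<xi>) has_vector_derivative \<xi>) (at 0)"
    by (auto intro!: derivative_eq_intros)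
  ultimately have X_deriv: "(X has_vector_derivative \<xi>) (at 0)"
    unfolding X_def using has_vector_derivative_scaleR[of "\<lambda>t. inverse (N t)" 0 0 UNIV "\<lambda>t. x + t *\<^sub>R \<xi>" \<xi>]
    by (simp add: N0)
  have "((\<lambda>t. s + t * \<sigma>) has_real_derivative \<sigma>) (at 0)"
    by (auto intro!: derivative_eq_intros)
  from lawlor_map_deriv[OF X_deriv this]
  have "((\<lambda>t. lawlor_map (X t, s + t * \<sigma>)) has_vector_derivative tangent_vec x s \<xi> \<sigma>) (at 0)"
    by (simp add: X_def N0)
  moreover have "smooth_on {-1<..<1} (\<lambda>t. lawlor_map (X t, s + t * \<sigma>))"
    by (rule smooth_on_subset[where U = UNIV], intro smooth_on_compose[OF lawlor_map_smooth]
         smooth_on_Pair X_smooth smooth_on_add smooth_on_mult smooth_on_id smooth_on_const) auto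
  moreover have "(\<lambda>t. lawlor_map (X t, s + t * \<sigma>)) ` {-1<..<1} \<subseteq> lawlor a \<psi>"
    unfolding lawlor_eq_image using X_sphere by blast
  moreover have "lawlor_map (X 0, s + 0 * \<sigma>) = lawlor_map (x, s)" by (simp add: X_def N0)
  ultimately show ?thesis
    unfolding tangent_space_def by (intro CollectI exI[of _ 1] conjI exI[of _ "\<lambda>t. lawlor_map (X t, s + t * \<sigma>)"]) auto
qed

text \<open>
  A smooth curve in \<open>L\<close> starting in the domain of \<open>coords j\<close> stays there for a short time and is
  the image of the differentiable curve \<open>coords j \<circ> \<gamma>\<close> of parameters, whose sphere component has
  constant norm and hence velocity orthogonal to \<open>x\<close>.
\<close>

lemma tangent_space_lawlorE:
  assumes x: "x \<in> sphere 0 1" and v: "v \<in> tangent_space (lawlor a \<psi>) (lawlor_map (x, s))"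
  obtains \<xi> \<sigma> where "x \<bullet> \<xi> = 0" "v = tangent_vec x s \<xi> \<sigma>"
proof -
  obtain e \<gamma> where e: "e > 0" and \<gamma>: "smooth_on {-e<..<e::real} \<gamma>" "\<gamma> ` {-e<..<e} \<subseteq> lawlor a \<psi>"
    "\<gamma> 0 = lawlor_map (x, s)" "(\<gamma> has_vector_derivative v) (at 0)"
    using v unfolding tangent_space_def by blast
  obtain j where j: "x $ j \<noteq> 0" using unit_vector_nonzero_coordinate[OF x] .
  define N where "N = {-e<..<e} \<inter> \<gamma> -` coords_domain j"
  have N: "open N" "0 \<in> N"
    unfolding N_def using j e \<gamma>(3) lawlor_map_in_coords_domain
    by (auto intro!: continuous_open_preimage smooth_on_imp_continuous_on[OF \<gamma>(1)] open_coords_domain)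
  define X where "X t = fst (coords j (\<gamma> t))" for t
  define S where "S t = snd (coords j (\<gamma> t))" for t
  have XS0: "X 0 = x" "S 0 = s" using coords_lawlor_map[OF j] by (simp_all add: X_def S_def \<gamma>(3))
  have XS: "X t \<in> sphere 0 1 \<and> lawlor_map (X t, S t) = \<gamma> t" if t: "t \<in> N" for t
  proof -
    have "\<gamma> t \<in> lawlor a \<psi>" using t \<gamma>(2) by (auto simp: N_def)
    then obtain y u where y: "y \<in> sphere 0 1" "\<gamma> t = lawlor_map (y, u)"
      unfolding lawlor_eq_image by blast
    then have "y $ j \<noteq> 0" using t lawlor_map_in_coords_domain by (auto simp: N_def)
    then show ?thesis using y coords_lawlor_map by (simp add: X_def S_def)
  qed
  define D where "D = frechet_derivative (coords j) (at (\<gamma> 0))"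
  have dcoords: "(coords j has_derivative D) (at (\<gamma> 0))"
    unfolding D_def by (rule smooth_on_has_derivative[OF coords_smooth]) (use N in \<open>simp add: N_def\<close>)
  have dc: "((\<lambda>t. coords j (\<gamma> t)) has_vector_derivative D v) (at 0)"
    using has_derivative_compose[OF \<gamma>(4)[unfolded has_vector_derivative_def] dcoords]
      linear_cmul[OF has_derivative_linear[OF dcoords]]
    by (simp add: has_vector_derivative_def)
  have dX: "(X has_vector_derivative fst (D v)) (at 0)"
    unfolding X_def by (rule bounded_linear.has_vector_derivative[OF bounded_linear_fst dc])
  have dS: "(S has_real_derivative snd (D v)) (at 0)"
    unfolding S_def has_real_derivative_iff_has_vector_derivative
    by (rule bounded_linear.has_vector_derivative[OF bounded_linear_snd dc])
  have "(\<gamma> has_vector_derivative tangent_vec x s (fst (D v)) (snd (D v))) (at 0)"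
    by (rule has_vector_derivative_transform_within_open[OF _ N, where f = "\<lambda>t. lawlor_map (X t, S t)"])
       (use lawlor_map_deriv[OF dX dS] XS XS0 in auto)
  then have "v = tangent_vec x s (fst (D v)) (snd (D v))"
    by (rule vector_derivative_unique_at[OF \<gamma>(4)])
  moreover have "x \<bullet> fst (D v) = 0"
  proof -
    have "((\<lambda>t. X t \<bullet> X t) has_vector_derivative x \<bullet> fst (D v) + fst (D v) \<bullet> x) (at 0)"
      using bounded_bilinear.has_vector_derivative[OF bounded_bilinear_inner dX dX] by (simp add: XS0)
    then have "((\<lambda>t. 1) has_vector_derivative x \<bullet> fst (D v) + fst (D v) \<bullet> x) (at 0)"
      by (rule has_vector_derivative_transform_within_open[OF _ N]) (use XS in \<open>auto simp: norm_eq_1\<close>)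
    then show ?thesis
      using vector_derivative_unique_at[OF _ has_vector_derivative_const] by (fastforce simp: inner_commute)
  qed
  ultimately show ?thesis using that by blast
qed

end

section \<open>The Kaehler forms in coordinates\<close>

lemma wedge_dz_dzbar: "wedge (dz j) (dzbar k) u v = u $ j * cnj (v $ k) - v $ j * cnj (u $ k)"
  by (simp add: wedge_def dz_def dzbar_def)

lemma diff_cnj_eq_Im: "x * cnj y - y * cnj x = 2 * \<i> * complex_of_real (Im (x * cnj y))"
  using complex_diff_cnj[of "x * cnj y"] by (simp add: mult.commute)

lemma omega_st_eq: "omega_st z u v = - complex_of_real (\<Sum>j\<in>UNIV. Im (u $ j * cnj (v $ j)))"
  unfolding omega_st_def wedge_dz_dzbar diff_cnj_eq_Im sum_distrib_left[symmetric]
  by (simp add: of_real_sum)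

text \<open>
  The Fubini-Study form has the potential \<open>ln fs_weight\<close>.  Its real partial derivatives are computed
  along \<open>t \<mapsto> z + c t e\<^sub>j\<close> for a complex \<open>c\<close>, so that \<open>c = 1\<close> and \<open>c = \<i>\<close> give the
  \<open>x\<close>- and the \<open>y\<close>-derivative together.
\<close>

definition fs_weight :: "complex ^ 'n::finite \<Rightarrow> real" where
  "fs_weight z = 1 + (\<Sum>j\<in>UNIV. (cmod (z $ j))\<^sup>2)"

lemma fs_weight_pos: "fs_weight z > 0"
  by (simp add: fs_weight_def add_pos_nonneg sum_nonneg)

lemma fs_weight_add_axis:
  "fs_weight (z + axis k (c * complex_of_real t))
     = fs_weight z + 2 * Re (cnj c * z $ k) * t + (cmod c)\<^sup>2 * t\<^sup>2"
proof -
  have "(\<Sum>j\<in>UNIV - {k}. (cmod ((z + axis k (c * complex_of_real t)) $ j))\<^sup>2)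
      = (\<Sum>j\<in>UNIV - {k}. (cmod (z $ j))\<^sup>2)"
    by (intro sum.cong) (auto simp: axis_def)
  moreover have "(cmod (z $ k + c * complex_of_real t))\<^sup>2
      = (cmod (z $ k))\<^sup>2 + 2 * Re (cnj c * z $ k) * t + (cmod c)\<^sup>2 * t\<^sup>2"
    unfolding cmod_power2 by (simp add: power2_eq_square algebra_simps)
  ultimately show ?thesis
    by (simp add: fs_weight_def sum.remove[of UNIV k])
qed

lemma fs_weight_deriv:
  "((\<lambda>t. fs_weight (z + axis k (c * complex_of_real t))) has_real_derivative 2 * Re (cnj c * z $ k)) (at 0)"
  unfolding fs_weight_add_axis by (auto intro!: derivative_eq_intros)

lemma fs_potential_deriv:
  "((\<lambda>t. complex_of_real (ln (fs_weight (z + axis k (c * complex_of_real t)))))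
     has_vector_derivative complex_of_real (2 * Re (cnj c * z $ k) / fs_weight z)) (at 0)"
proof -
  have "((\<lambda>t. ln (fs_weight (z + axis k (c * complex_of_real t)))) has_real_derivative
      1 / fs_weight (z + axis k (c * complex_of_real 0)) * (2 * Re (cnj c * z $ k))) (at 0)"
    by (rule DERIV_chain2[OF DERIV_ln_divide[OF fs_weight_pos] fs_weight_deriv])
  then have "((\<lambda>t. ln (fs_weight (z + axis k (c * complex_of_real t)))) has_real_derivative
      2 * Re (cnj c * z $ k) / fs_weight z) (at 0)"
    by (rule DERIV_cong) (simp add: axis_def zero_vec_def[symmetric])
  then show ?thesis by (rule has_vector_derivative_of_real)
qed

lemma partial_zbar_fs_potential:
  "partial_zbar k (\<lambda>w. complex_of_real (ln (fs_weight w))) z = z $ k / complex_of_real (fs_weight z)"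
proof -
  have x: "partial_x k (\<lambda>w. complex_of_real (ln (fs_weight w))) z
      = complex_of_real (2 * Re (z $ k) / fs_weight z)"
    using vector_derivative_at[OF fs_potential_deriv[of z k 1]] by (simp add: partial_x_def)
  have y: "partial_y k (\<lambda>w. complex_of_real (ln (fs_weight w))) z
      = complex_of_real (2 * Im (z $ k) / fs_weight z)"
    using vector_derivative_at[OF fs_potential_deriv[of z k "\<i>"]] by (simp add: partial_y_def)
  show ?thesis
    unfolding partial_zbar_def x y using fs_weight_pos[of z]
    by (simp add: complex_eq_iff)
qed

lemma fs_gradient_deriv:
  "((\<lambda>t. (z + axis j (c * complex_of_real t)) $ k
          / complex_of_real (fs_weight (z + axis j (c * complex_of_real t))))
     has_vector_derivative (if j = k then c else 0) / complex_of_real (fs_weight z)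
       - z $ k * complex_of_real (2 * Re (cnj c * z $ j) / (fs_weight z)\<^sup>2)) (at 0)"
proof -
  have ax0: "axis j (0::complex) = 0" by (simp add: axis_def zero_vec_def[symmetric])
  have nz: "fs_weight w \<noteq> 0" for w :: "complex ^ 'n" using fs_weight_pos[of w] by simp
  have 1: "((\<lambda>t. (z + axis j (c * complex_of_real t)) $ k) has_vector_derivative (if j = k then c else 0)) (at 0)"
    by (cases "j = k") (auto intro!: derivative_eq_intros simp: axis_def)
  have "((\<lambda>t. inverse (fs_weight (z + axis j (c * complex_of_real t)))) has_real_derivative
      - (inverse (fs_weight (z + axis j (c * complex_of_real 0))) * (2 * Re (cnj c * z $ j))
         * inverse (fs_weight (z + axis j (c * complex_of_real 0))))) (at 0)"
    by (rule DERIV_inverse'[OF fs_weight_deriv nz])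
  then have "((\<lambda>t. inverse (fs_weight (z + axis j (c * complex_of_real t)))) has_real_derivative
      - (2 * Re (cnj c * z $ j) / (fs_weight z)\<^sup>2)) (at 0)"
    by (rule DERIV_cong) (simp add: ax0 divide_inverse power2_eq_square)
  from has_vector_derivative_mult[OF 1 has_vector_derivative_of_real[OF this]]
  show ?thesis by (simp add: divide_inverse ax0)
qed

lemma partial_z_fs_gradient:
  "partial_z j (\<lambda>z. z $ k / complex_of_real (fs_weight z)) z
     = (if j = k then 1 else 0) / complex_of_real (fs_weight z)
       - cnj (z $ j) * z $ k / (complex_of_real (fs_weight z))\<^sup>2"
proof -
  let ?W = "complex_of_real (fs_weight z)"
  have x: "partial_x j (\<lambda>z. z $ k / complex_of_real (fs_weight z)) z
      = (if j = k then 1 else 0) / ?W - z $ k * complex_of_real (2 * Re (z $ j) / (fs_weight z)\<^sup>2)"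
    using vector_derivative_at[OF fs_gradient_deriv[of z j 1 k]] by (simp add: partial_x_def)
  have y: "partial_y j (\<lambda>z. z $ k / complex_of_real (fs_weight z)) z
      = (if j = k then \<i> else 0) / ?W - z $ k * complex_of_real (2 * Im (z $ j) / (fs_weight z)\<^sup>2)"
    using vector_derivative_at[OF fs_gradient_deriv[of z j "\<i>" k]] by (simp add: partial_y_def)
  have cnj: "cnj (z $ j) = complex_of_real (Re (z $ j)) - \<i> * complex_of_real (Im (z $ j))"
    by (simp add: complex_eq_iff)
  show ?thesis
    unfolding partial_z_def x y cnj
    by (simp add: algebra_simps add_divide_distrib diff_divide_distrib)
qed

text \<open>
  The mixed derivatives of the potential are \<open>\<delta>\<^sub>j\<^sub>k / W - cnj z\<^sub>j z\<^sub>k / W\<^sup>2\<close>.  The second term has rank one,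
  so its double sum factors into Hermitian products with \<open>z\<close>.
\<close>

lemma omega_FS_eq:
  "omega_FS z u v = - complex_of_real
     ((\<Sum>j\<in>UNIV. Im (u $ j * cnj (v $ j))) / fs_weight z
      - Im ((\<Sum>j\<in>UNIV. cnj (z $ j) * u $ j) * cnj (\<Sum>j\<in>UNIV. cnj (z $ j) * v $ j)) / (fs_weight z)\<^sup>2)"
proof -
  let ?W = "complex_of_real (fs_weight z)"
  let ?A = "\<Sum>j\<in>UNIV. cnj (z $ j) * u $ j" and ?B = "\<Sum>j\<in>UNIV. cnj (z $ j) * v $ j"
  have "del_delbar (\<lambda>w. complex_of_real (ln (1 + (\<Sum>j\<in>UNIV. (cmod (w $ j))\<^sup>2)))) z u v
     = (\<Sum>j\<in>UNIV. \<Sum>k\<in>UNIV. ((if j = k then 1 else 0) / ?W - cnj (z $ j) * z $ k / ?W\<^sup>2)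
          * (u $ j * cnj (v $ k) - v $ j * cnj (u $ k)))"
    unfolding del_delbar_def fs_weight_def[symmetric] partial_zbar_fs_potential[abs_def]
      partial_z_fs_gradient wedge_dz_dzbar ..
  also have "\<dots> = (\<Sum>j\<in>UNIV. \<Sum>k\<in>UNIV.
        (if j = k then (u $ j * cnj (v $ j) - v $ j * cnj (u $ j)) / ?W else 0)
        - ((cnj (z $ j) * u $ j) * cnj (cnj (z $ k) * v $ k)
            - (cnj (z $ j) * v $ j) * cnj (cnj (z $ k) * u $ k)) / ?W\<^sup>2)"
    by (intro sum.cong refl) (auto simp: algebra_simps diff_divide_distrib)
  also have "\<dots> = (\<Sum>j\<in>UNIV. (u $ j * cnj (v $ j) - v $ j * cnj (u $ j)) / ?W)
        - (?A * cnj ?B - ?B * cnj ?A) / ?W\<^sup>2"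
    by (simp add: sum_subtractf sum_product cnj_sum sum_divide_distrib[symmetric])
  also have "\<dots> = 2 * \<i> * complex_of_real ((\<Sum>j\<in>UNIV. Im (u $ j * cnj (v $ j))) / fs_weight z
      - Im (?A * cnj ?B) / (fs_weight z)\<^sup>2)"
    unfolding diff_cnj_eq_Im of_real_diff of_real_divide of_real_power of_real_sum
      right_diff_distrib sum_distrib_left sum_divide_distrib times_divide_eq_right ..
  finally show ?thesis unfolding omega_FS_def by simp
qed

section \<open>The Lagrangian conditions\<close>

lemma cnj_exp_i_mult_self: "cnj (exp (\<i> * complex_of_real t)) * exp (\<i> * complex_of_real t) = 1"
  by (simp add: exp_cnj mult_exp_exp)

context lawlor_parameters
begin

text \<open>
  The unit factors \<open>exp(i\<phi>\<^sub>j)\<close> cancel, and in the imaginary part the radii do too.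
\<close>

lemma sum_Im_tangent_vec:
  assumes "x \<bullet> \<xi> = 0" "x \<bullet> \<eta> = 0"
  shows "(\<Sum>j\<in>UNIV. Im (tangent_vec x s \<xi> \<sigma> $ j * cnj (tangent_vec x s \<eta> \<tau> $ j))) = 0"
proof -
  have "Im (tangent_vec x s \<xi> \<sigma> $ j * cnj (tangent_vec x s \<eta> \<tau> $ j))
      = lawlor_q a s * \<sigma> * (x $ j * \<eta> $ j) - lawlor_q a s * \<tau> * (x $ j * \<xi> $ j)" for j
  proof -
    let ?e = "exp (\<i> * complex_of_real (lawlor_phi a \<psi> j s))" and ?r = "lawlor_r a j s"
    let ?c = "Complex s (lawlor_q a s)"
    have eq: "tangent_vec x s \<xi> \<sigma> $ j * cnj (tangent_vec x s \<eta> \<tau> $ j)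
      = (cnj ?e * ?e) * ((complex_of_real (\<xi> $ j * ?r) + complex_of_real (\<sigma> * x $ j / ?r) * ?c)
        * cnj (complex_of_real (\<eta> $ j * ?r) + complex_of_real (\<tau> * x $ j / ?r) * ?c))"
      by (simp only: tangent_vec_def vec_lambda_beta complex_cnj_mult mult_ac)
    show ?thesis
      unfolding eq cnj_exp_i_mult_self mult_1 using r_pos[of j s] by (simp add: field_simps)
  qed
  then have "(\<Sum>j\<in>UNIV. Im (tangent_vec x s \<xi> \<sigma> $ j * cnj (tangent_vec x s \<eta> \<tau> $ j)))
      = lawlor_q a s * \<sigma> * (x \<bullet> \<eta>) - lawlor_q a s * \<tau> * (x \<bullet> \<xi>)"
    by (simp add: sum_subtractf sum_distrib_left[symmetric] inner_vec_def)
  then show ?thesis using assms by simp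
qed

text \<open>
  Here \<open>r\<^sub>j\<^sup>2 = 1/a\<^sub>j + s\<^sup>2\<close> enters: the part \<open>s\<^sup>2\<close>, common to all \<open>j\<close>, drops out since \<open>x \<bullet> \<xi> = 0\<close>,
  and the weights \<open>1/a\<^sub>j\<close> remain.
\<close>

lemma hermitian_product_tangent_vec:
  assumes "x \<in> sphere 0 1" "x \<bullet> \<xi> = 0"
  shows "(\<Sum>j\<in>UNIV. cnj (lawlor_map (x, s) $ j) * tangent_vec x s \<xi> \<sigma> $ j)
    = complex_of_real (\<Sum>j\<in>UNIV. x $ j * \<xi> $ j / a j) + complex_of_real \<sigma> * Complex s (lawlor_q a s)"
proof -
  let ?c = "Complex s (lawlor_q a s)"
  have "cnj (lawlor_map (x, s) $ j) * tangent_vec x s \<xi> \<sigma> $ j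
      = complex_of_real (x $ j * \<xi> $ j / a j + s\<^sup>2 * (x $ j * \<xi> $ j)) + complex_of_real ((x $ j)\<^sup>2) * (complex_of_real \<sigma> * ?c)" for j
  proof -
    let ?e = "exp (\<i> * complex_of_real (lawlor_phi a \<psi> j s))" and ?r = "lawlor_r a j s"
    have "cnj (lawlor_map (x, s) $ j) * tangent_vec x s \<xi> \<sigma> $ j
      = (cnj ?e * ?e) * (complex_of_real (x $ j * ?r) *
         (complex_of_real (\<xi> $ j * ?r) + complex_of_real (\<sigma> * x $ j / ?r) * ?c))"
      by (simp only: lawlor_map_def tangent_vec_def vec_lambda_beta complex_cnj_mult fst_conv snd_conv
           complex_cnj_complex_of_real mult_ac)
    also have "\<dots> = complex_of_real (x $ j * \<xi> $ j * ?r\<^sup>2) + complex_of_real ((x $ j)\<^sup>2) * (complex_of_real \<sigma> * ?c)"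
      unfolding cnj_exp_i_mult_self using r_pos[of j s] by (simp add: algebra_simps power2_eq_square)
    finally show ?thesis by (simp add: r_sq algebra_simps)
  qed
  then have "(\<Sum>j\<in>UNIV. cnj (lawlor_map (x, s) $ j) * tangent_vec x s \<xi> \<sigma> $ j)
      = complex_of_real ((\<Sum>j\<in>UNIV. x $ j * \<xi> $ j / a j) + s\<^sup>2 * (x \<bullet> \<xi>))
        + complex_of_real (\<Sum>j\<in>UNIV. (x $ j)\<^sup>2) * (complex_of_real \<sigma> * ?c)"
    by (simp add: sum.distrib sum_distrib_left sum_distrib_right inner_vec_def)
  then show ?thesis using assms unfolding sphere_iff_sum_squares by simp
qed

lemma omega_FS_tangent_vec:
  assumes "x \<in> sphere 0 1" "x \<bullet> \<xi> = 0" "x \<bullet> \<eta> = 0"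
  shows "omega_FS (lawlor_map (x, s)) (tangent_vec x s \<xi> \<sigma>) (tangent_vec x s \<eta> \<tau>)
    = complex_of_real (lawlor_q a s * (\<sigma> * (\<Sum>j\<in>UNIV. x $ j * \<eta> $ j / a j)
        - \<tau> * (\<Sum>j\<in>UNIV. x $ j * \<xi> $ j / a j)) / (fs_weight (lawlor_map (x, s)))\<^sup>2)"
  unfolding omega_FS_eq sum_Im_tangent_vec[OF assms(2,3)]
    hermitian_product_tangent_vec[OF assms(1,2)] hermitian_product_tangent_vec[OF assms(1,3)]
  by (simp add: algebra_simps)

lemma lagrangian_omega_st: "lagrangian omega_st (lawlor a \<psi>)"
  unfolding lagrangian_def
proof (intro conjI half_dim_submanifold_lawlor ballI)
  fix p u v assume p: "p \<in> lawlor a \<psi>" and u: "u \<in> tangent_space (lawlor a \<psi>) p"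
    and v: "v \<in> tangent_space (lawlor a \<psi>) p"
  obtain x s where x: "x \<in> sphere 0 1" and p': "p = lawlor_map (x, s)"
    using p unfolding lawlor_eq_image by blast
  obtain \<xi> \<sigma> where "x \<bullet> \<xi> = 0" "u = tangent_vec x s \<xi> \<sigma>"
    using tangent_space_lawlorE[OF x u[unfolded p']] .
  moreover obtain \<eta> \<tau> where "x \<bullet> \<eta> = 0" "v = tangent_vec x s \<eta> \<tau>"
    using tangent_space_lawlorE[OF x v[unfolded p']] .
  ultimately show "omega_st p u v = 0"
    by (simp only: omega_st_eq sum_Im_tangent_vec of_real_0 minus_zero)
qed

text \<open>
  In the forward direction, for \<open>\<sigma> = 1\<close>, \<open>\<xi> = 0\<close> and \<open>\<tau> = 0\<close> the form reduces to a positive multiple of \<open>\<Sum> x\<^sub>k \<eta>\<^sub>k / a\<^sub>k\<close>, and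
  vectors supported on two indices compare the corresponding \<open>a\<close>'s.
\<close>

lemma lagrangian_omega_FS_iff: "lagrangian omega_FS (lawlor a \<psi>) \<longleftrightarrow> (\<forall>i j. a i = a j)"
proof
  assume eq: "\<forall>i j. a i = a j"
  show "lagrangian omega_FS (lawlor a \<psi>)"
    unfolding lagrangian_def
  proof (intro conjI half_dim_submanifold_lawlor ballI)
    fix p u v assume p: "p \<in> lawlor a \<psi>" and u: "u \<in> tangent_space (lawlor a \<psi>) p"
      and v: "v \<in> tangent_space (lawlor a \<psi>) p"
    obtain x s where x: "x \<in> sphere 0 1" and p': "p = lawlor_map (x, s)"
      using p unfolding lawlor_eq_image by blast
    obtain \<xi> \<sigma> where \<xi>: "x \<bullet> \<xi> = 0" "u = tangent_vec x s \<xi> \<sigma>"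
      using tangent_space_lawlorE[OF x u[unfolded p']] .
    obtain \<eta> \<tau> where \<eta>: "x \<bullet> \<eta> = 0" "v = tangent_vec x s \<eta> \<tau>"
      using tangent_space_lawlorE[OF x v[unfolded p']] .
    have "(\<Sum>j\<in>UNIV. x $ j * \<zeta> $ j / a j) = 0" if "x \<bullet> \<zeta> = 0" for \<zeta>
    proof -
      fix i
      have "(\<Sum>j\<in>UNIV. x $ j * \<zeta> $ j / a j) = (\<Sum>j\<in>UNIV. x $ j * \<zeta> $ j / a i)"
        by (intro sum.cong refl) (use eq in metis)
      then show ?thesis using that by (simp add: sum_divide_distrib[symmetric] inner_vec_def)
    qed
    then show "omega_FS p u v = 0"
      using omega_FS_tangent_vec[OF x \<xi>(1) \<eta>(1)] \<xi> \<eta> by (simp add: p')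
  qed
next
  assume lag: "lagrangian omega_FS (lawlor a \<psi>)"
  show "\<forall>i j. a i = a j"
  proof (intro allI, rule ccontr)
    fix i j assume neq: "a i \<noteq> a j"
    then have ij: "i \<noteq> j" by auto
    define x :: "real ^ 'n" where "x = axis i (1 / sqrt 2) + axis j (1 / sqrt 2)"
    define \<eta> :: "real ^ 'n" where "\<eta> = axis i 1 - axis j 1"
    have two: "(\<Sum>k\<in>UNIV. f k) = f i + f j" if "\<And>k. k \<noteq> i \<Longrightarrow> k \<noteq> j \<Longrightarrow> f k = 0" for f :: "'n \<Rightarrow> real"
    proof -
      have "(\<Sum>k\<in>UNIV. f k) = (\<Sum>k\<in>{i, j}. f k)"
        by (rule sum.mono_neutral_right) (use that in auto)
      then show ?thesis using ij by simp
    qed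
    have comps: "x $ i = 1 / sqrt 2" "x $ j = 1 / sqrt 2" "\<eta> $ i = 1" "\<eta> $ j = -1"
      "\<And>k. k \<noteq> i \<Longrightarrow> k \<noteq> j \<Longrightarrow> x $ k = 0" "\<And>k. k \<noteq> i \<Longrightarrow> k \<noteq> j \<Longrightarrow> \<eta> $ k = 0"
      using ij by (auto simp: x_def \<eta>_def axis_def)
    have x: "x \<in> sphere 0 1"
      unfolding sphere_iff_sum_squares by (subst two) (auto simp: comps power_divide)
    have x\<eta>: "x \<bullet> \<eta> = 0"
      unfolding inner_vec_def by (subst two) (auto simp: comps)
    have "lawlor_map (x, 0) \<in> lawlor a \<psi>" using x unfolding lawlor_eq_image by blast
    moreover have "tangent_vec x 0 0 1 \<in> tangent_space (lawlor a \<psi>) (lawlor_map (x, 0))"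
      by (rule tangent_vec_in_tangent_space[OF x]) simp
    moreover have "tangent_vec x 0 \<eta> 0 \<in> tangent_space (lawlor a \<psi>) (lawlor_map (x, 0))"
      by (rule tangent_vec_in_tangent_space[OF x x\<eta>])
    ultimately have "omega_FS (lawlor_map (x, 0)) (tangent_vec x 0 0 1) (tangent_vec x 0 \<eta> 0) = 0"
      using lag unfolding lagrangian_def by blast
    then have "(\<Sum>k\<in>UNIV. x $ k * \<eta> $ k / a k) = 0"
      using omega_FS_tangent_vec[OF x _ x\<eta>, of 0 0 1 0] q_pos[of 0] fs_weight_pos[of "lawlor_map (x, 0)"]
      by (simp del: of_real_sum)
    moreover have "(\<Sum>k\<in>UNIV. x $ k * \<eta> $ k / a k) = (1 / a i - 1 / a j) / sqrt 2"
      by (subst two) (auto simp: comps diff_divide_distrib mult.commute)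
    ultimately show False using neq by simp
  qed
qed

end

section \<open>The phase of the holomorphic volume form\<close>

lemma det_of_real_matrix:
  "det (\<chi> i j. complex_of_real (A $ i $ j)) = complex_of_real (det (A :: real ^ 'n ^ 'n::finite))"
  by (simp add: det_def)

text \<open>
  Rotate by a real orthogonal matrix that sends the direction of \<open>b\<close> to a coordinate axis.  In the row
  of that axis the contribution of \<open>A\<close> vanishes, since \<open>b\<close> annihilates \<open>A\<close> from the left, and what
  remains is \<open>c\<close> times a real row.  In all other rows the rank-one term vanishes, so they are real.
\<close>

lemma det_real_plus_rank_one:
  fixes A :: "real ^ 'n ^ 'n::finite" and b :: "real ^ 'n" and \<tau> :: "'n \<Rightarrow> real" and c :: complex
  assumes "b \<noteq> 0" and bA: "\<And>k. (\<Sum>j\<in>UNIV. b $ j * A $ j $ k) = 0"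
  obtains D :: real where
    "det (\<chi> j k. complex_of_real (A $ j $ k) + complex_of_real (\<tau> k * b $ j) * c) = complex_of_real D * c"
proof -
  let ?M = "(\<chi> j k. complex_of_real (A $ j $ k) + complex_of_real (\<tau> k * b $ j) * c) :: complex ^ 'n ^ 'n"
  fix l :: 'n
  obtain Q :: "real ^ 'n ^ 'n" where Q: "orthogonal_matrix Q" "Q *v axis l 1 = b /\<^sub>R norm b"
    using orthogonal_matrix_exists_basis[of "b /\<^sub>R norm b" l] \<open>b \<noteq> 0\<close> by auto
  let ?Qt = "(\<chi> i j. complex_of_real (transpose Q $ i $ j)) :: complex ^ 'n ^ 'n"
  have Ql: "b $ i = norm b * Q $ i $ l" for i
  proof -
    have "Q $ i $ l = (Q *v axis l 1) $ i"
      by (simp add: matrix_vector_mult_basis column_def)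
    then show ?thesis using Q(2) \<open>b \<noteq> 0\<close> by simp
  qed
  have Qb: "(\<Sum>i\<in>UNIV. Q $ i $ j * b $ i) = (if j = l then norm b else 0)" for j
  proof -
    have "(transpose Q ** Q) $ j $ l = (if j = l then 1 else 0)"
      using Q(1) by (simp add: orthogonal_matrix_def mat_def)
    then have "(\<Sum>i\<in>UNIV. Q $ i $ j * Q $ i $ l) = (if j = l then 1 else 0)"
      by (simp add: matrix_matrix_mult_def transpose_def)
    moreover have "(\<Sum>i\<in>UNIV. Q $ i $ j * b $ i) = norm b * (\<Sum>i\<in>UNIV. Q $ i $ j * Q $ i $ l)"
      unfolding sum_distrib_left by (intro sum.cong refl) (subst Ql, simp)
    ultimately show ?thesis by simp
  qed
  have QA: "(\<Sum>i\<in>UNIV. Q $ i $ l * A $ i $ k) = 0" for k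
  proof -
    have "norm b * (\<Sum>i\<in>UNIV. Q $ i $ l * A $ i $ k) = (\<Sum>i\<in>UNIV. b $ i * A $ i $ k)"
      unfolding sum_distrib_left by (intro sum.cong refl) (subst Ql, simp)
    then show ?thesis using bA \<open>b \<noteq> 0\<close> by simp
  qed
  define R :: "real ^ 'n ^ 'n" where
    "R = (\<chi> j. if j = l then (\<chi> k. norm b * \<tau> k) else (\<chi> k. \<Sum>i\<in>UNIV. Q $ i $ j * A $ i $ k))"
  have entry: "(?Qt ** ?M) $ j $ k = complex_of_real (\<Sum>i\<in>UNIV. Q $ i $ j * A $ i $ k)
      + complex_of_real (\<tau> k * (\<Sum>i\<in>UNIV. Q $ i $ j * b $ i)) * c" for j k
    by (simp add: matrix_matrix_mult_def transpose_def algebra_simps sum.distrib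
        sum_distrib_left sum_distrib_right)
  have "?Qt ** ?M = (\<chi> j. if j = l then c *s (\<chi> k. complex_of_real (R $ j $ k))
                          else (\<chi> k. complex_of_real (R $ j $ k)))"
    unfolding vec_eq_iff entry by (simp add: R_def Qb QA del: of_real_sum)
  then have "det (?Qt ** ?M) = c * det (\<chi> j. if j = l then (\<chi> k. complex_of_real (R $ j $ k))
                          else (\<chi> k. complex_of_real (R $ j $ k)))"
    by (simp only: det_row_mul)
  also have "(\<chi> j. if j = l then (\<chi> k. complex_of_real (R $ j $ k))
                          else (\<chi> k. complex_of_real (R $ j $ k))) = (\<chi> j k. complex_of_real (R $ j $ k))"
    by (simp add: vec_eq_iff)
  finally have "complex_of_real (det Q) * det ?M = complex_of_real (det R) * c"
    by (simp add: det_mul det_of_real_matrix)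
  moreover have "det Q \<noteq> 0" using det_orthogonal_matrix[OF Q(1)] by auto
  ultimately have "det ?M = complex_of_real (det R / det Q) * c"
    by (simp add: field_simps)
  then show ?thesis by (rule that)
qed

context lawlor_parameters
begin

text \<open>
  The matrix of \<open>Omega\<close> has the phases \<open>exp(i\<phi>\<^sub>j)\<close> as row factors.  After they are removed it is
  \<open>A + (s + iq) b \<sigma>\<^sup>T\<close> with \<open>A\<^sub>j\<^sub>k = \<xi>\<^sub>k\<^sub>j r\<^sub>j\<close> and \<open>b\<^sub>j = x\<^sub>j / r\<^sub>j\<close>, and \<open>b\<^sup>T A = 0\<close> is the
  orthogonality of \<open>x\<close> and \<open>\<xi>\<^sub>k\<close>.
\<close>

lemma Omega_tangent_vec:
  assumes x: "x \<in> sphere 0 1" and \<xi>: "\<And>k. x \<bullet> \<xi> k = 0"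
  obtains K :: real where "Omega (\<lambda>k. tangent_vec x s (\<xi> k) (\<sigma> k))
    = \<i> * exp (\<i> * complex_of_real (\<Sum>j\<in>UNIV. \<psi> j)) * complex_of_real K"
proof -
  let ?c = "Complex s (lawlor_q a s)"
  define A :: "real ^ 'n ^ 'n" where "A = (\<chi> j k. \<xi> k $ j * lawlor_r a j s)"
  define b :: "real ^ 'n" where "b = (\<chi> j. x $ j / lawlor_r a j s)"
  have rnz: "lawlor_r a j s \<noteq> 0" for j using r_pos[of j s] by simp
  obtain i where "x $ i \<noteq> 0" using unit_vector_nonzero_coordinate[OF x] .
  then have "b $ i \<noteq> 0" by (simp add: b_def rnz)
  then have "b \<noteq> 0" by auto
  moreover have "(\<Sum>j\<in>UNIV. b $ j * A $ j $ k) = 0" for k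
    using \<xi>[of k] by (simp add: A_def b_def rnz inner_vec_def)
  ultimately obtain D :: real where
    D: "det (\<chi> j k. complex_of_real (A $ j $ k) + complex_of_real (\<sigma> k * b $ j) * ?c) = complex_of_real D * ?c"
    using det_real_plus_rank_one by blast
  have "Omega (\<lambda>k. tangent_vec x s (\<xi> k) (\<sigma> k))
      = det (\<chi> j. exp (\<i> * complex_of_real (lawlor_phi a \<psi> j s)) *s
          (\<chi> k. complex_of_real (A $ j $ k) + complex_of_real (\<sigma> k * b $ j) * ?c))"
    unfolding Omega_def dz_def
    by (rule arg_cong[where f = det]) (simp add: vec_eq_iff tangent_vec_def A_def b_def mult.commute)
  also have "\<dots> = (\<Prod>j\<in>UNIV. exp (\<i> * complex_of_real (lawlor_phi a \<psi> j s))) * (complex_of_real D * ?c)"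
    unfolding det_rows_mul D ..
  also have "(\<Prod>j\<in>UNIV. exp (\<i> * complex_of_real (lawlor_phi a \<psi> j s)))
      = exp (\<i> * complex_of_real (\<Sum>j\<in>UNIV. \<psi> j)) * exp (\<i> * complex_of_real (\<Sum>j\<in>UNIV. lawlor_angle a j s))"
    by (simp add: exp_sum[symmetric] exp_add[symmetric] lawlor_phi_eq sum.distrib sum_distrib_left distrib_left)
  also have "\<dots> * (complex_of_real D * ?c) = \<i> * exp (\<i> * complex_of_real (\<Sum>j\<in>UNIV. \<psi> j))
      * complex_of_real (sqrt (1 + (s * sqrt (excess a s))\<^sup>2) * lawlor_q a s * D)"
  proof -
    \<comment> \<open>The sum of the angles is \<open>arctan W\<close> and \<open>s + iq\<close> is \<open>q (W + i)\<close>, so the product is governed by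
      \<open>(1 + iW) (W + i) = i (1 + W\<^sup>2)\<close>.\<close>
    define W where "W = s * sqrt (excess a s)"
    have s: "s = W * lawlor_q a s"
      using excess_pos[of s] by (simp add: W_def lawlor_q_def)
    have pos: "1 + W\<^sup>2 > 0" by (simp add: add_pos_nonneg)
    have e: "exp (\<i> * complex_of_real (arctan W)) = Complex 1 W / complex_of_real (sqrt (1 + W\<^sup>2))"
      by (simp add: exp_Euler sin_of_real cos_of_real cos_arctan sin_arctan complex_eq_iff)
    have c: "?c = Complex W 1 * complex_of_real (lawlor_q a s)"
      by (subst (1) s) (simp add: complex_eq_iff)
    have prod: "Complex 1 W * Complex W 1 = \<i> * (complex_of_real (sqrt (1 + W\<^sup>2)) * complex_of_real (sqrt (1 + W\<^sup>2)))"
      using pos by (simp add: complex_eq_iff power2_eq_square flip: of_real_mult)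
    have "exp (\<i> * complex_of_real (arctan W)) * ?c
        = (Complex 1 W * Complex W 1) * complex_of_real (lawlor_q a s) / complex_of_real (sqrt (1 + W\<^sup>2))"
      unfolding e c by simp
    then have "exp (\<i> * complex_of_real (arctan W)) * ?c
        = \<i> * complex_of_real (sqrt (1 + W\<^sup>2) * lawlor_q a s)"
      unfolding prod using pos by simp
    then show ?thesis unfolding sum_angle W_def[symmetric] by (simp add: algebra_simps)
  qed
  finally show ?thesis by (rule that)
qed

text \<open>
  For the converse it suffices to exhibit tangent vectors with \<open>Omega v \<noteq> 0\<close>.  At \<open>x = e\<^sub>l\<close>, \<open>s = 0\<close> the
  tangent vectors in the directions \<open>\<xi> = e\<^sub>k\<close> for \<open>k \<noteq> l\<close> and \<open>\<sigma> = 1\<close> form a diagonal matrix with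
  nonzero entries.
\<close>

lemma Im_Omega_vanishes_iff:
  "(\<forall>p\<in>lawlor a \<psi>. \<forall>v. (\<forall>k. v k \<in> tangent_space (lawlor a \<psi>) p) \<longrightarrow> Im (Omega v) = 0)
     \<longleftrightarrow> cos (\<Sum>j\<in>UNIV. \<psi> j) = 0"
proof -
  have Im: "Im (\<i> * exp (\<i> * complex_of_real (\<Sum>j\<in>UNIV. \<psi> j)) * complex_of_real K) = cos (\<Sum>j\<in>UNIV. \<psi> j) * K" for K
    by (simp add: exp_Euler sin_of_real cos_of_real del: of_real_sum)
  show ?thesis
  proof
    assume cos: "cos (\<Sum>j\<in>UNIV. \<psi> j) = 0"
    show "\<forall>p\<in>lawlor a \<psi>. \<forall>v. (\<forall>k. v k \<in> tangent_space (lawlor a \<psi>) p) \<longrightarrow> Im (Omega v) = 0"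
    proof (intro ballI allI impI)
      fix p and v :: "'n \<Rightarrow> complex ^ 'n"
      assume p: "p \<in> lawlor a \<psi>" and v: "\<forall>k. v k \<in> tangent_space (lawlor a \<psi>) p"
      obtain x s where x: "x \<in> sphere 0 1" and p': "p = lawlor_map (x, s)"
        using p unfolding lawlor_eq_image by blast
      have "\<exists>\<xi> \<sigma>. x \<bullet> \<xi> = 0 \<and> v k = tangent_vec x s \<xi> \<sigma>" for k
        using tangent_space_lawlorE[OF x v[unfolded p', rule_format, of k]] by metis
      then obtain \<xi> \<sigma> where \<xi>: "\<And>k. x \<bullet> \<xi> k = 0" and v': "v = (\<lambda>k. tangent_vec x s (\<xi> k) (\<sigma> k))"
        by metis
      obtain K where "Omega v = \<i> * exp (\<i> * complex_of_real (\<Sum>j\<in>UNIV. \<psi> j)) * complex_of_real K"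
        unfolding v' by (rule Omega_tangent_vec[OF x \<xi>])
      then show "Im (Omega v) = 0" unfolding Im cos by (simp only: Im cos)
    qed
  next
    assume vanish: "\<forall>p\<in>lawlor a \<psi>. \<forall>v. (\<forall>k. v k \<in> tangent_space (lawlor a \<psi>) p) \<longrightarrow> Im (Omega v) = 0"
    fix l :: 'n
    define x :: "real ^ 'n" where "x = axis l 1"
    define \<xi> :: "'n \<Rightarrow> real ^ 'n" where "\<xi> k = (if k = l then 0 else axis k 1)" for k
    define \<sigma> :: "'n \<Rightarrow> real" where "\<sigma> k = (if k = l then 1 else 0)" for k
    let ?v = "\<lambda>k. tangent_vec x 0 (\<xi> k) (\<sigma> k)"
    have x: "x \<in> sphere 0 1" by (simp add: x_def)
    have \<xi>: "x \<bullet> \<xi> k = 0" for k by (simp add: x_def \<xi>_def inner_axis_axis)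
    obtain K where K: "Omega ?v = \<i> * exp (\<i> * complex_of_real (\<Sum>j\<in>UNIV. \<psi> j)) * complex_of_real K"
      by (rule Omega_tangent_vec[OF x \<xi>])
    have "Omega ?v = (\<Prod>j\<in>UNIV. ?v j $ j)"
      unfolding Omega_def dz_def
      by (subst det_diagonal) (auto simp: tangent_vec_def x_def \<xi>_def \<sigma>_def axis_def)
    moreover have "?v j $ j \<noteq> 0" for j
      using r_pos[of j 0] q_pos[of 0]
      by (cases "j = l") (auto simp: tangent_vec_def x_def \<xi>_def \<sigma>_def axis_def Complex_eq_0)
    ultimately have "Omega ?v \<noteq> 0" by simp
    then have "K \<noteq> 0" unfolding K by auto
    moreover have "lawlor_map (x, 0) \<in> lawlor a \<psi>" using x unfolding lawlor_eq_image by blast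
    then have "Im (Omega ?v) = 0"
      using bspec[OF vanish, THEN spec[of _ ?v]] tangent_vec_in_tangent_space[OF x \<xi>] by simp
    ultimately show "cos (\<Sum>j\<in>UNIV. \<psi> j) = 0" unfolding K Im by simp
  qed
qed

end

theorem theorem1p1:
  fixes a \<psi> :: "'n::finite \<Rightarrow> real"
  assumes "\<And>j. a j > 0"
  shows "closed (lawlor a \<psi>)
    \<and> diffeomorphic ((sphere 0 1 :: (real ^ 'n) set) \<times> (UNIV :: real set)) (lawlor a \<psi>)
    \<and> lagrangian omega_st (lawlor a \<psi>)
    \<and> (lagrangian omega_FS (lawlor a \<psi>) \<longleftrightarrow> (\<forall>i j. a i = a j))
    \<and> (special_lagrangian omega_st (lawlor a \<psi>) \<longleftrightarrow> cos (\<Sum>j\<in>UNIV. \<psi> j) = 0)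
    \<and> (cos (\<Sum>j\<in>UNIV. \<psi> j) = 0 \<longrightarrow>
         (special_lagrangian omega_FS (lawlor a \<psi>) \<longleftrightarrow> (\<forall>i j. a i = a j)))"
proof -
  interpret lawlor_parameters a \<psi> by unfold_locales (rule assms)
  show ?thesis
    unfolding special_lagrangian_def Im_Omega_vanishes_iff
    using closed_lawlor diffeomorphic_lawlor lagrangian_omega_st lagrangian_omega_FS_iff by blast
qed

end
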